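(* There is a computable procedure which, given any finite sequence $Cr_1,\ldots,Cr_K$ of closed critical formulas of $PA\epsilon$, terminates and produces a finite $\epsilon$-substitution $S$ that is correct and solving for $Cr_1,\ldots,Cr_K$; that is, for every $(c_{\exists x.\phi[x,\vec y]}(\vec t),v)\in S$ with $v\neq{?}$ one has $\overline{S}\vDash \phi[v,\vec t]\wedge\bigwedge_{u<v}\neg\phi[u,\vec t]$, and for every $I$ with $1\le I\le K$ one has $\overline{S}\vDash Cr_I$.
   Context: **Language.** $\mathcal{L}_0$ is the language of first-order arithmetic with a predicate symbol for each primitive recursively definable relation and with exactly the function symbols $0$ and $\mathbf{S}$. Given a language $\mathcal{L}$, its Skolemization $\mathcal{L}'$ is obtained by adding, for each formula $\exists x.\phi[x,y_1,\ldots,y_k]$ of $\mathcal{L}$ with $\phi$ quantifier-free, such that $\phi[x,0,\ldots,0]$ contains no closed Skolem terms and $y_1,\ldots,y_k$ include all free variables of $\phi$ besides $x$, a $k$-ary function symbol (Skolem function) $c_{\exists x.\phi[x,y_1,\ldots,y_k]}$ (here $k=0$ is allowed, and $\phi$ may contain Skolem functions whose arguments depend on $x$). Put $\mathcal{L}_{n+1}:=\mathcal{L}_n'$, $\mathcal{L}_\omega:=\bigcup_n\mathcal{L}_n$, and let $\mathcal{L}\epsilon$ be the quantifier-free part of $\mathcal{L}_\omega$. Within $\mathcal{L}\epsilon$, $\exists x.\phi[x,\vec t]$ abbreviates $\phi[c_{\exists x.\phi[x,\vec y]}(\vec t),\vec t]$ and $\forall x.\phi[x,\vec t]$ abbreviates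 $\phi[c_{\exists x.\neg\phi[x,\vec y]}(\vec t),\vec t]$. **Critical formulas.** The critical formulas of $PA\epsilon$ are the $\mathcal{L}\epsilon$-formulas of the following forms (with $\exists$ read as the abbreviation above): $\phi[t]\rightarrow\exists x.\phi[x]$; $\ \phi[0]\wedge\neg\phi[t]\rightarrow\exists x.(\phi[x]\wedge\neg\phi[\mathbf{S}x])$; $\ \neg s=0\rightarrow\exists x.\,s=\mathbf{S}x$. Here $\phi$ may contain further terms as parameters. Closed means without free variables. **$\epsilon$-substitutions.** A canonical term is a term $c(\vec t)$ with $c$ a Skolem function and each $t_i$ a numeral. An $\epsilon$-substitution is a function $S$ whose domain is a set of canonical terms and each of whose values is either a numeral or the symbol $?$. It is total if its domain is the set of all canonical terms. Its standard extension is $\overline{S}:=S\cup\{(e,?)\mid e \text{ canonical},\ e\notin\operatorname{dom}(S)\}$. **Evaluation.** For a closed term $t$, $\hat S(t)$ is defined as follows. $\hat S(0):=0$ and $\hat S(\mathbf{S}t):=\mathbf{S}\hat S(t)$. If $t=c(\vec s)$ is a non-canonical Skolem term and some $\hat S(s_i)$ is not a numeral, then $\hat S(t):=c(\hat S(\vec s))$; if every $\hat S(s_i)$ is a numeral, then $\hat S(t):=\hat S(c(\hat S(\vec s)))$, where $\hat S(s_1,\ldots,s_k):=\hat S(s_1),\ldots,\hat S(s_k)$. If $t$ is canonical, then $\hat S(t):=0$ if $S(t)={?}$, $\hat S(t):=S(t)$ if $S(t)$ is a numeral, and $\hat S(t):=t$ if $t\notin\operatorname{dom}(S)$. **Satisfaction.**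 For closed formulas of $\mathcal{L}\epsilon$: $S\vDash Rt_1\cdots t_n$ (respectively $S\vDash\neg Rt_1\cdots t_n$) iff every $\hat S(t_i)$ is a numeral and $R\hat S(t_1)\cdots\hat S(t_n)$ (respectively $\neg R\hat S(t_1)\cdots\hat S(t_n)$) holds in the standard model; $S\vDash\phi\wedge\psi$ iff $S\vDash\phi$ and $S\vDash\psi$; $S\vDash\neg(\phi\wedge\psi)$ iff $S\vDash\neg\phi$ or $S\vDash\neg\psi$; $S\vDash\phi\vee\psi$ iff $S\vDash\phi$ or $S\vDash\psi$; $S\vDash\neg(\phi\vee\psi)$ iff $S\vDash\neg\phi$ and $S\vDash\neg\psi$. Moreover $S\vDash\neg\neg\phi$ iff $S\vDash\phi$, and $\phi\rightarrow\psi$ is read as $\neg\phi\vee\psi$. *)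

theory Defs
  imports Main "HOL-Library.Nat_Bijection"
begin

section \<open>Partial recursive functions\<close>

text \<open>Definitions of partial recursive functions. The definitions without \<open>RMin\<close> double as the
  predicate symbols of the language of arithmetic.\<close>

datatype recf =
    RZero
  | RSucc
  | RProj nat
  | RComp recf "recf list"
  | RPrec recf recf
  | RMin recf

text \<open>\<open>rec_eval f xs y\<close>: the partial function defined by \<open>f\<close> is defined at \<open>xs\<close>, with value \<open>y\<close>.\<close>

inductive rec_eval :: "recf \<Rightarrow> nat list \<Rightarrow> nat \<Rightarrow> bool" where
  "rec_eval RZero xs 0"
| "rec_eval RSucc [x] (Suc x)"
| "i < length xs \<Longrightarrow> rec_eval (RProj i) xs (xs ! i)"
| "list_all2 (\<lambda>g y. rec_eval g xs y) gs ys \<Longrightarrow> rec_eval f ys z \<Longrightarrow> rec_eval (RComp f gs) xs z"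
| "rec_eval f xs y \<Longrightarrow> rec_eval (RPrec f g) (0 # xs) y"
| "rec_eval (RPrec f g) (n # xs) r \<Longrightarrow> rec_eval g (n # r # xs) y \<Longrightarrow>
     rec_eval (RPrec f g) (Suc n # xs) y"
| "rec_eval f (z # xs) 0 \<Longrightarrow> (\<And>y. y < z \<Longrightarrow> \<exists>w>0. rec_eval f (y # xs) w) \<Longrightarrow>
     rec_eval (RMin f) xs z"

inductive is_primrec :: "nat \<Rightarrow> recf \<Rightarrow> bool" where
  "is_primrec n RZero"
| "is_primrec 1 RSucc"
| "i < n \<Longrightarrow> is_primrec n (RProj i)"
| "is_primrec (length gs) f \<Longrightarrow> (\<And>g. g \<in> set gs \<Longrightarrow> is_primrec n g) \<Longrightarrow>
     is_primrec n (RComp f gs)"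
| "is_primrec n f \<Longrightarrow> is_primrec (Suc (Suc n)) g \<Longrightarrow> is_primrec (Suc n) (RPrec f g)"

text \<open>A primitive recursive relation is given by a representing function that takes the value \<open>0\<close>
  exactly on the tuples in the relation.\<close>

definition rel_holds :: "recf \<Rightarrow> nat list \<Rightarrow> bool" where
  "rel_holds R ns \<longleftrightarrow> rec_eval R ns 0"

text \<open>The predicate symbol for equality represents \<open>x = y\<close> by \<open>(x - y) + (y - x)\<close>, with truncated
  subtraction; \<open>monus_rec\<close> maps \<open>[y, x]\<close> to \<open>x - y\<close>.\<close>

definition monus_rec :: recf where
  "monus_rec = RPrec (RProj 0) (RComp (RPrec RZero (RProj 0)) [RProj 1])"

definition add_rec :: recf where
  "add_rec = RPrec (RProj 0) (RComp RSucc [RProj 1])"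

definition eq_rec :: recf where
  "eq_rec = RComp add_rec [monus_rec, RComp monus_rec [RProj 1, RProj 0]]"


section \<open>The quantifier-free language with Skolem functions\<close>

text \<open>A Skolem function is named by a formula \<open>\<phi>[x,y\<^sub>1,\<dots>,y\<^sub>k]\<close> in the fixed variables
  \<open>x = Var 0\<close> and \<open>y\<^sub>i = Var i\<close>, together with its arity \<open>k\<close>. In \<open>Sk \<phi> ts\<close> the arity is the length
  of \<open>ts\<close>. The variables of \<open>\<phi>\<close> belong to the name of the function symbol and are not free
  variables of the term.\<close>

datatype tm =
    Var nat
  | Zero
  | Succ tm
  | Sk fm "tm list"
and fm =
    Atom recf "tm list"
  | Neg fm
  | And fm fm
  | Or fm fm

abbreviation Imp :: "fm \<Rightarrow> fm \<Rightarrow> fm" where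
  "Imp \<phi> \<psi> \<equiv> Or (Neg \<phi>) \<psi>"

abbreviation Eq :: "tm \<Rightarrow> tm \<Rightarrow> fm" where
  "Eq s t \<equiv> Atom eq_rec [s, t]"

primrec num :: "nat \<Rightarrow> tm" where
  "num 0 = Zero"
| "num (Suc n) = Succ (num n)"

primrec tm_vars :: "tm \<Rightarrow> nat set" where
  "tm_vars (Var i) = {i}"
| "tm_vars Zero = {}"
| "tm_vars (Succ t) = tm_vars t"
| "tm_vars (Sk \<phi> ts) = \<Union> (set (map tm_vars ts))"

primrec fm_vars :: "fm \<Rightarrow> nat set" where
  "fm_vars (Atom R ts) = \<Union> (set (map tm_vars ts))"
| "fm_vars (Neg \<phi>) = fm_vars \<phi>"
| "fm_vars (And \<phi> \<psi>) = fm_vars \<phi> \<union> fm_vars \<psi>"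
| "fm_vars (Or \<phi> \<psi>) = fm_vars \<phi> \<union> fm_vars \<psi>"

primrec subterms :: "tm \<Rightarrow> tm set" where
  "subterms (Var i) = {Var i}"
| "subterms Zero = {Zero}"
| "subterms (Succ t) = insert (Succ t) (subterms t)"
| "subterms (Sk \<phi> ts) = insert (Sk \<phi> ts) (\<Union> (set (map subterms ts)))"

primrec fm_subterms :: "fm \<Rightarrow> tm set" where
  "fm_subterms (Atom R ts) = \<Union> (set (map subterms ts))"
| "fm_subterms (Neg \<phi>) = fm_subterms \<phi>"
| "fm_subterms (And \<phi> \<psi>) = fm_subterms \<phi> \<union> fm_subterms \<psi>"
| "fm_subterms (Or \<phi> \<psi>) = fm_subterms \<phi> \<union> fm_subterms \<psi>"

primrec tm_subst :: "(nat \<Rightarrow> tm) \<Rightarrow> tm \<Rightarrow> tm" where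
  "tm_subst \<sigma> (Var i) = \<sigma> i"
| "tm_subst \<sigma> Zero = Zero"
| "tm_subst \<sigma> (Succ t) = Succ (tm_subst \<sigma> t)"
| "tm_subst \<sigma> (Sk \<phi> ts) = Sk \<phi> (map (tm_subst \<sigma>) ts)"

primrec fm_subst :: "(nat \<Rightarrow> tm) \<Rightarrow> fm \<Rightarrow> fm" where
  "fm_subst \<sigma> (Atom R ts) = Atom R (map (tm_subst \<sigma>) ts)"
| "fm_subst \<sigma> (Neg \<phi>) = Neg (fm_subst \<sigma> \<phi>)"
| "fm_subst \<sigma> (And \<phi> \<psi>) = And (fm_subst \<sigma> \<phi>) (fm_subst \<sigma> \<psi>)"
| "fm_subst \<sigma> (Or \<phi> \<psi>) = Or (fm_subst \<sigma> \<phi>) (fm_subst \<sigma> \<psi>)"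

text \<open>\<open>inst \<phi> s ts\<close> is \<open>\<phi>[s,t\<^sub>1,\<dots>,t\<^sub>k]\<close> for \<open>\<phi>[x,y\<^sub>1,\<dots>,y\<^sub>k]\<close> as above.\<close>

definition inst :: "fm \<Rightarrow> tm \<Rightarrow> tm list \<Rightarrow> fm" where
  "inst \<phi> s ts = fm_subst (\<lambda>i. if i \<le> length ts then (s # ts) ! i else Var i) \<phi>"

definition fm_subst1 :: "nat \<Rightarrow> tm \<Rightarrow> fm \<Rightarrow> fm" where
  "fm_subst1 x t \<phi> = fm_subst (Var(x := t)) \<phi>"

text \<open>Terms and formulas over a given set of Skolem functions, each a pair of arity and formula.\<close>

primrec tm_over :: "(nat \<times> fm) set \<Rightarrow> tm \<Rightarrow> bool" where
  "tm_over \<Sigma> (Var i) \<longleftrightarrow> True"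
| "tm_over \<Sigma> Zero \<longleftrightarrow> True"
| "tm_over \<Sigma> (Succ t) \<longleftrightarrow> tm_over \<Sigma> t"
| "tm_over \<Sigma> (Sk \<phi> ts) \<longleftrightarrow> (length ts, \<phi>) \<in> \<Sigma> \<and> list_all (tm_over \<Sigma>) ts"

primrec fm_over :: "(nat \<times> fm) set \<Rightarrow> fm \<Rightarrow> bool" where
  "fm_over \<Sigma> (Atom R ts) \<longleftrightarrow> is_primrec (length ts) R \<and> list_all (tm_over \<Sigma>) ts"
| "fm_over \<Sigma> (Neg \<phi>) \<longleftrightarrow> fm_over \<Sigma> \<phi>"
| "fm_over \<Sigma> (And \<phi> \<psi>) \<longleftrightarrow> fm_over \<Sigma> \<phi> \<and> fm_over \<Sigma> \<psi>"
| "fm_over \<Sigma> (Or \<phi> \<psi>) \<longleftrightarrow> fm_over \<Sigma> \<phi> \<and> fm_over \<Sigma> \<psi>"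

definition no_closed_skolem :: "fm \<Rightarrow> bool" where
  "no_closed_skolem \<phi> \<longleftrightarrow> (\<forall>\<psi> ts. Sk \<psi> ts \<in> fm_subterms \<phi> \<longrightarrow> tm_vars (Sk \<psi> ts) \<noteq> {})"

primrec skolem_funs :: "nat \<Rightarrow> (nat \<times> fm) set" where
  "skolem_funs 0 = {}"
| "skolem_funs (Suc n) = skolem_funs n \<union>
     {(k, \<phi>). fm_over (skolem_funs n) \<phi> \<and> fm_vars \<phi> \<subseteq> {0..k} \<and>
        no_closed_skolem (inst \<phi> (Var 0) (replicate k Zero))}"

definition Skolem :: "(nat \<times> fm) set" where
  "Skolem = (\<Union>n. skolem_funs n)"

abbreviation L_tm :: "tm \<Rightarrow> bool" where
  "L_tm \<equiv> tm_over Skolem"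

abbreviation L_fm :: "fm \<Rightarrow> bool" where
  "L_fm \<equiv> fm_over Skolem"


section \<open>Critical formulas\<close>

text \<open>\<open>ex_abbrev x \<psi> \<chi>\<close>: the quantifier-free formula \<open>\<chi>\<close> is what \<open>\<exists>x. \<psi>\<close> abbreviates. A formula
  can be written as \<open>\<phi>[x,t\<^sub>1,\<dots>,t\<^sub>k]\<close> in several ways, so this is a relation.\<close>

definition ex_abbrev :: "nat \<Rightarrow> fm \<Rightarrow> fm \<Rightarrow> bool" where
  "ex_abbrev x \<psi> \<chi> \<longleftrightarrow>
     (\<exists>\<phi> ts. (length ts, \<phi>) \<in> Skolem \<and> (\<forall>t\<in>set ts. L_tm t \<and> x \<notin> tm_vars t) \<and>
        \<psi> = inst \<phi> (Var x) ts \<and> \<chi> = inst \<phi> (Sk \<phi> ts) ts)"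

inductive critical_form :: "fm \<Rightarrow> bool" where
  "ex_abbrev x \<phi> \<chi> \<Longrightarrow> critical_form (Imp (fm_subst1 x t \<phi>) \<chi>)"
| "ex_abbrev x (And \<phi> (Neg (fm_subst1 x (Succ (Var x)) \<phi>))) \<chi> \<Longrightarrow>
     critical_form (Imp (And (fm_subst1 x Zero \<phi>) (Neg (fm_subst1 x t \<phi>))) \<chi>)"
| "x \<notin> tm_vars s \<Longrightarrow> ex_abbrev x (Eq s (Succ (Var x))) \<chi> \<Longrightarrow>
     critical_form (Imp (Neg (Eq s Zero)) \<chi>)"

definition critical :: "fm \<Rightarrow> bool" where
  "critical \<phi> \<longleftrightarrow> L_fm \<phi> \<and> critical_form \<phi>"


section \<open>Epsilon-substitutions\<close>

definition canonical :: "tm \<Rightarrow> bool" where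
  "canonical e \<longleftrightarrow> (\<exists>\<phi> ns. e = Sk \<phi> (map num ns) \<and> (length ns, \<phi>) \<in> Skolem)"

text \<open>\<open>Unknown\<close> is the symbol \<open>?\<close>.\<close>

datatype evalue = Unknown | Num nat

type_synonym esubst = "tm \<rightharpoonup> evalue"

definition eps_subst :: "esubst \<Rightarrow> bool" where
  "eps_subst S \<longleftrightarrow> (\<forall>e\<in>dom S. canonical e)"

definition std_ext :: "esubst \<Rightarrow> esubst" where
  "std_ext S = (\<lambda>e. if e \<notin> dom S \<and> canonical e then Some Unknown else S e)"

text \<open>Numerals evaluate to themselves, so canonical Skolem terms need no separate clause.\<close>

primrec eval :: "esubst \<Rightarrow> tm \<Rightarrow> tm" where
  "eval S (Var i) = Var i"
| "eval S Zero = Zero"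
| "eval S (Succ t) = Succ (eval S t)"
| "eval S (Sk \<phi> ts) =
     (let e = Sk \<phi> (map (eval S) ts) in
      if set (map (eval S) ts) \<subseteq> range num
      then (case S e of None \<Rightarrow> e | Some Unknown \<Rightarrow> Zero | Some (Num n) \<Rightarrow> num n)
      else e)"

fun sat :: "esubst \<Rightarrow> fm \<Rightarrow> bool" where
  "sat S (Atom R ts) \<longleftrightarrow> (\<exists>ns. map (eval S) ts = map num ns \<and> rel_holds R ns)"
| "sat S (And \<phi> \<psi>) \<longleftrightarrow> sat S \<phi> \<and> sat S \<psi>"
| "sat S (Or \<phi> \<psi>) \<longleftrightarrow> sat S \<phi> \<or> sat S \<psi>"
| "sat S (Neg (Atom R ts)) \<longleftrightarrow> (\<exists>ns. map (eval S) ts = map num ns \<and> \<not> rel_holds R ns)"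
| "sat S (Neg (And \<phi> \<psi>)) \<longleftrightarrow> sat S (Neg \<phi>) \<or> sat S (Neg \<psi>)"
| "sat S (Neg (Or \<phi> \<psi>)) \<longleftrightarrow> sat S (Neg \<phi>) \<and> sat S (Neg \<psi>)"
| "sat S (Neg (Neg \<phi>)) \<longleftrightarrow> sat S \<phi>"

definition correct :: "esubst \<Rightarrow> bool" where
  "correct S \<longleftrightarrow>
     (\<forall>\<phi> ts v. S (Sk \<phi> ts) = Some (Num v) \<longrightarrow>
        sat (std_ext S) (inst \<phi> (num v) ts) \<and>
        (\<forall>u<v. sat (std_ext S) (Neg (inst \<phi> (num u) ts))))"

definition solving :: "esubst \<Rightarrow> fm list \<Rightarrow> bool" where
  "solving S Cr \<longleftrightarrow> (\<forall>C\<in>set Cr. sat (std_ext S) C)"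


section \<open>Encoding of the finite objects as natural numbers\<close>

primrec recf_code :: "recf \<Rightarrow> nat" where
  "recf_code RZero = prod_encode (0, 0)"
| "recf_code RSucc = prod_encode (1, 0)"
| "recf_code (RProj i) = prod_encode (2, i)"
| "recf_code (RComp f gs) =
     prod_encode (3, prod_encode (recf_code f, list_encode (map recf_code gs)))"
| "recf_code (RPrec f g) = prod_encode (4, prod_encode (recf_code f, recf_code g))"
| "recf_code (RMin f) = prod_encode (5, recf_code f)"

primrec tm_code :: "tm \<Rightarrow> nat" and fm_code :: "fm \<Rightarrow> nat" where
  "tm_code (Var i) = prod_encode (0, i)"
| "tm_code Zero = prod_encode (1, 0)"
| "tm_code (Succ t) = prod_encode (2, tm_code t)"
| "tm_code (Sk \<phi> ts) = prod_encode (3, prod_encode (fm_code \<phi>, list_encode (map tm_code ts)))"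
| "fm_code (Atom R ts) = prod_encode (0, prod_encode (recf_code R, list_encode (map tm_code ts)))"
| "fm_code (Neg \<phi>) = prod_encode (1, fm_code \<phi>)"
| "fm_code (And \<phi> \<psi>) = prod_encode (2, prod_encode (fm_code \<phi>, fm_code \<psi>))"
| "fm_code (Or \<phi> \<psi>) = prod_encode (3, prod_encode (fm_code \<phi>, fm_code \<psi>))"

primrec evalue_code :: "evalue \<Rightarrow> nat" where
  "evalue_code Unknown = 0"
| "evalue_code (Num n) = Suc n"

definition fms_code :: "fm list \<Rightarrow> nat" where
  "fms_code Cr = list_encode (map fm_code Cr)"

text \<open>A finite substitution is encoded by any listing of its graph without repetitions.\<close>

definition codes_esubst :: "nat \<Rightarrow> esubst \<Rightarrow> bool" where
  "codes_esubst m S \<longleftrightarrow>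
     (\<exists>ps. distinct (map fst ps) \<and> S = map_of ps \<and>
        m = list_encode (map (\<lambda>(e, v). prod_encode (tm_code e, evalue_code v)) ps))"


section \<open>Adequacy of the encodings\<close>

inductive_cases rec_eval_elims:
  "rec_eval RZero xs y"
  "rec_eval RSucc xs y"
  "rec_eval (RProj i) xs y"
  "rec_eval (RComp f gs) xs y"
  "rec_eval (RPrec f g) (0 # xs) y"
  "rec_eval (RPrec f g) (Suc n # xs) y"
  "rec_eval (RMin f) xs y"

lemma rec_eval_functional: "rec_eval f xs y \<Longrightarrow> rec_eval f xs z \<Longrightarrow> y = z"
proof (induction arbitrary: z rule: rec_eval.induct)
  case (4 xs gs ys f y)
  from "4.prems" obtain ys' where ys': "list_all2 (\<lambda>g y. rec_eval g xs y) gs ys'" "rec_eval f ys' z"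
    by (auto elim: rec_eval_elims(4))
  have "ys = ys'"
    using "4.IH"(1) ys'(1) by (auto simp: list_all2_conv_all_nth intro!: nth_equalityI)
  then show ?case using "4.IH"(2) ys'(2) by blast
next
  case (7 f y xs)
  from "7.prems" have z: "rec_eval f (z # xs) 0" "\<And>w. w < z \<Longrightarrow> \<exists>v>0. rec_eval f (w # xs) v"
    by (auto elim: rec_eval_elims(7))
  show ?case
  proof (rule linorder_cases[of y z])
    assume "y < z"
    then show ?thesis using z(2) "7.IH"(1) by fastforce
  next
    assume "z < y"
    then show ?thesis using "7.IH"(2)[of z] z(1) by fastforce
  qed
next
  case (6 f g n xs r y)
  from "6.prems" obtain r' where "rec_eval (RPrec f g) (n # xs) r'" "rec_eval g (n # r' # xs) z"
    by (rule rec_eval_elims(6))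
  then show ?case using "6.IH" by blast
next
  case (5 f xs y g)
  from "5.prems" show ?case by (rule rec_eval_elims(5)) (rule "5.IH")
qed (auto elim: rec_eval_elims(1-3))

lemma is_primrec_total: "is_primrec n f \<Longrightarrow> length xs = n \<Longrightarrow> \<exists>y. rec_eval f xs y"
proof (induction arbitrary: xs rule: is_primrec.induct)
  case (2 xs)
  then show ?case by (cases xs) (auto intro: rec_eval.intros)
next
  case (4 gs f n)
  then have "\<forall>g\<in>set gs. \<exists>y. rec_eval g xs y" by blast
  then obtain h where "\<forall>g\<in>set gs. rec_eval g xs (h g)" by metis
  then have h: "list_all2 (\<lambda>g y. rec_eval g xs y) gs (map h gs)"
    by (auto simp: list_all2_conv_all_nth)
  obtain y where "rec_eval f (map h gs) y" using "4.IH"(1)[of "map h gs"] by auto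
  with h show ?case by (blast intro: rec_eval.intros(4))
next
  case (5 n f g)
  then obtain k ys where xs: "xs = k # ys" "length ys = n" by (cases xs) auto
  have "\<exists>y. rec_eval (RPrec f g) (k # ys) y"
  proof (induction k)
    case 0
    show ?case using "5.IH"(1)[OF xs(2)] by (blast intro: rec_eval.intros)
  next
    case (Suc k)
    then obtain r where r: "rec_eval (RPrec f g) (k # ys) r" by blast
    obtain y where "rec_eval g (k # r # ys) y" using "5.IH"(2)[of "k # r # ys"] xs(2) by auto
    with r show ?case by (blast intro: rec_eval.intros)
  qed
  then show ?case using xs by simp
qed (blast intro: rec_eval.intros(1,3))+

lemma is_primrec_eq_rec: "is_primrec 2 eq_rec"
proof -
  have proj: "is_primrec n (RProj i)" if "i < n" for i n
    using that by (rule is_primrec.intros)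
  have "is_primrec (Suc 0) (RPrec RZero (RProj 0))"
    by (intro is_primrec.intros) simp
  then have "is_primrec (Suc (Suc 0)) monus_rec" "is_primrec (Suc (Suc 0)) add_rec"
    unfolding monus_rec_def add_rec_def
    using is_primrec.intros(2) by (auto intro!: is_primrec.intros)
  then show ?thesis
    unfolding eq_rec_def by (auto intro!: is_primrec.intros proj simp: numeral_2_eq_2)
qed

lemma rec_eval_proj: "i < length xs \<Longrightarrow> y = xs ! i \<Longrightarrow> rec_eval (RProj i) xs y"
  by (auto intro: rec_eval.intros)

lemma rec_eval_eq_rec: "rec_eval eq_rec [a, b] ((a - b) + (b - a))"
proof -
  have pred: "rec_eval (RPrec RZero (RProj 0)) [n] (n - 1)" for n
  proof (induction n)
    case (Suc n)
    show ?case by (rule rec_eval.intros(6)[OF Suc]) (simp add: rec_eval_proj)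
  qed (auto intro: rec_eval.intros(1,5))
  have monus: "rec_eval monus_rec [n, m] (m - n)" for n m
    unfolding monus_rec_def
  proof (induction n)
    case (Suc n)
    show ?case
      using pred[of "m - n"]
      by (intro rec_eval.intros(6)[OF Suc] rec_eval.intros(4)[where ys = "[m - n]"])
        (simp_all add: rec_eval_proj)
  qed (rule rec_eval.intros(5), simp add: rec_eval_proj)
  have add: "rec_eval add_rec [n, m] (n + m)" for n m
    unfolding add_rec_def
  proof (induction n)
    case (Suc n)
    show ?case
      by (intro rec_eval.intros(6)[OF Suc] rec_eval.intros(4)[where ys = "[n + m]"])
        (simp_all add: rec_eval_proj rec_eval.intros(2))
  qed (rule rec_eval.intros(5), simp add: rec_eval_proj)
  have "rec_eval (RComp monus_rec [RProj 1, RProj 0]) [a, b] (a - b)"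
    by (rule rec_eval.intros(4)[where ys = "[b, a]"]) (simp_all add: rec_eval_proj monus)
  then show ?thesis
    unfolding eq_rec_def using monus add[of "b - a" "a - b"]
    by (intro rec_eval.intros(4)[where ys = "[b - a, a - b]"]) (simp_all add: add.commute)
qed

lemma rel_holds_eq_rec: "rel_holds eq_rec [a, b] \<longleftrightarrow> a = b"
  using rec_eval_eq_rec[of a b] rec_eval_functional[OF rec_eval_eq_rec[of a b], of 0]
  by (auto simp: rel_holds_def)

lemma map_inj_on_eq:
  "(\<And>x y. x \<in> set xs \<Longrightarrow> f x = f y \<Longrightarrow> x = y) \<Longrightarrow> map f xs = map f ys \<Longrightarrow> xs = ys"
  by (induction xs arbitrary: ys) (auto simp: Cons_eq_map_conv)

lemma recf_code_eq: "recf_code f = recf_code g \<Longrightarrow> f = g"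
proof (induction f arbitrary: g)
  case (RComp f gs)
  then show ?case by (cases g) (auto simp: list_encode_eq dest!: map_inj_on_eq[rotated])
next
  case RZero
  then show ?case by (cases g) auto
next
  case RSucc
  then show ?case by (cases g) auto
next
  case (RProj i)
  then show ?case by (cases g) auto
next
  case (RPrec f h)
  then show ?case by (cases g) auto
next
  case (RMin f)
  then show ?case by (cases g) auto
qed

lemma tm_code_eq: "tm_code s = tm_code t \<Longrightarrow> s = t"
  and fm_code_eq: "fm_code \<phi> = fm_code \<psi> \<Longrightarrow> \<phi> = \<psi>"
proof (induction s and \<phi> arbitrary: t and \<psi>)
  case (Var i)
  then show ?case by (cases t) auto
next
  case Zero
  then show ?case by (cases t) auto
next
  case (Succ s)
  then show ?case by (cases t) auto
next
  case (Sk \<phi> ts)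
  then show ?case by (cases t) (auto simp: list_encode_eq dest!: map_inj_on_eq[rotated])
next
  case (Atom R ts)
  then show ?case
    by (cases \<psi>) (auto simp: list_encode_eq dest!: recf_code_eq map_inj_on_eq[rotated])
next
  case (Neg \<phi>)
  then show ?case by (cases \<psi>) auto
next
  case (And \<phi> \<phi>')
  then show ?case by (cases \<psi>) auto
next
  case (Or \<phi> \<phi>')
  then show ?case by (cases \<psi>) auto
qed

lemma codes_esubst_functional: "codes_esubst m S \<Longrightarrow> codes_esubst m S' \<Longrightarrow> S = S'"
proof -
  have inj: "inj (\<lambda>(e, v). prod_encode (tm_code e, evalue_code v))"
  proof (rule injI, clarify)
    fix e v e' v'
    assume "prod_encode (tm_code e, evalue_code v) = prod_encode (tm_code e', evalue_code v')"
    then show "e = e' \<and> v = v'"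
      by (cases v; cases v') (auto dest: tm_code_eq)
  qed
  show "codes_esubst m S \<Longrightarrow> codes_esubst m S' \<Longrightarrow> S = S'"
    unfolding codes_esubst_def
    by (auto simp: list_encode_eq dest!: map_injective[OF _ inj])
qed

end

theory Submission
  imports Defs
begin

text \<open>A correct and solving finite substitution exists for a non-constructive reason: interpret every
  Skolem function in the standard model as the least witness if there is one. All critical formulas
  are then true, and evaluating them, together with the formulas that certify the values met on the
  way, consults only finitely many canonical terms, because the formula naming a Skolem function is
  a proper part of every term headed by it. The finite table of these values is the substitution.

  Computability then only needs the relation \<open>m codes a correct and solving substitution for c\<close> to be
  recursively enumerable, since an unbounded search finds such an \<open>m\<close>. Derivability from a finite set of
  Horn clauses over natural numbers with pairing is recursively enumerable, and a few dozen clauses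
  axiomatize evaluation of primitive recursive functions, of terms and of formulas.\<close>

section \<open>Computable functions\<close>

text \<open>The obstacle is that \<open>?\<close> stands for the absence of a witness and false
  atoms for the absence of truth, whereas Horn clauses can only assert presence. Correctness demands
  evidence for numeral values alone, so an entry \<open>?\<close> can be accepted without verifying
  that no witness exists. Falsity is made positive by deriving \<open>Unsat\<close> alongside
  \<open>Sat\<close>: a primitive recursive atom is total, so one of the two becomes derivable once
  its arguments have values.

  The two directions are asymmetric. The standard model only shows that some acceptable table
  exists; soundness concerns every number that is accepted. The table returned by the search may
  therefore differ from the standard values: an entry \<open>?\<close> for a term that does have a
  witness is harmless as long as the critical formulas still evaluate to true.\<close>

text \<open>The argument list is presented to \<open>f\<close> as an environment, so that pushing a new first argument is
  the shift \<open>\<lambda>i. e (Suc i)\<close> without any case distinction on the length.\<close>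

definition computable :: "nat \<Rightarrow> ((nat \<Rightarrow> nat) \<Rightarrow> nat) \<Rightarrow> bool" where
  "computable n f \<longleftrightarrow> (\<exists>r. \<forall>xs. length xs = n \<longrightarrow> rec_eval r xs (f ((!) xs)))"

definition decidable :: "nat \<Rightarrow> ((nat \<Rightarrow> nat) \<Rightarrow> bool) \<Rightarrow> bool" where
  "decidable n P \<longleftrightarrow> computable n (\<lambda>e. if P e then 0 else 1)"

named_theorems comp

lemma computableI: "(\<And>xs. length xs = n \<Longrightarrow> rec_eval r xs (f ((!) xs))) \<Longrightarrow> computable n f"
  by (auto simp: computable_def)

lemma computable_proj [comp]: "i < n \<Longrightarrow> computable n (\<lambda>e. e i)"
  by (rule computableI[where r = "RProj i"]) (auto intro: rec_eval.intros)

lemma computable_compose: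
  assumes "computable (length gs) f" "\<And>g. g \<in> set gs \<Longrightarrow> computable n g"
  shows "computable n (\<lambda>e. f ((!) (map (\<lambda>g. g e) gs)))"
proof -
  obtain r where r: "\<And>xs. length xs = length gs \<Longrightarrow> rec_eval r xs (f ((!) xs))"
    using assms(1) by (auto simp: computable_def)
  obtain h where h: "\<And>g xs. g \<in> set gs \<Longrightarrow> length xs = n \<Longrightarrow> rec_eval (h g) xs (g ((!) xs))"
    using assms(2) unfolding computable_def by metis
  show ?thesis
    by (rule computableI[where r = "RComp r (map h gs)"])
      (auto intro!: rec_eval.intros(4) r h simp: list_all2_conv_all_nth)
qed

lemma computable_compose1:
  assumes "computable 1 (\<lambda>e. h (e 0))" "computable n a"
  shows "computable n (\<lambda>e. h (a e))"
  using computable_compose[of "[a]" "\<lambda>e. h (e 0)" n] assms by auto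

lemma computable_compose2:
  assumes "computable 2 (\<lambda>e. h (e 0) (e 1))" "computable n a" "computable n b"
  shows "computable n (\<lambda>e. h (a e) (b e))"
  using computable_compose[of "[a, b]" "\<lambda>e. h (e 0) (e 1)" n] assms by (auto simp: numeral_2_eq_2)

lemma computable_Suc [comp]:
  assumes "computable n a" shows "computable n (\<lambda>e. Suc (a e))"
proof -
  have "computable 1 (\<lambda>e. Suc (e 0))"
    by (rule computableI[where r = RSucc]) (auto simp: length_Suc_conv intro: rec_eval.intros)
  then show ?thesis using assms by (rule computable_compose1)
qed

lemma computable_const [comp]: "computable n (\<lambda>_. c)"
proof (induction c)
  case 0
  show ?case by (rule computableI[where r = RZero]) (rule rec_eval.intros)
qed (rule computable_Suc)

lemma computable_rec [comp]:
  assumes "computable n a" "computable n m"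
    and "computable (Suc (Suc n)) (\<lambda>e. b (e 0) (e 1) (\<lambda>i. e (Suc (Suc i))))"
  shows "computable n (\<lambda>e. rec_nat (a e) (\<lambda>k r. b k r e) (m e))"
proof -
  obtain f where f: "\<And>xs. length xs = n \<Longrightarrow> rec_eval f xs (a ((!) xs))"
    using assms(1) by (auto simp: computable_def)
  obtain g where g: "\<And>xs. length xs = Suc (Suc n) \<Longrightarrow>
      rec_eval g xs (b (xs ! 0) (xs ! 1) (\<lambda>i. xs ! Suc (Suc i)))"
    using assms(3) by (auto simp: computable_def)
  have rec: "rec_eval (RPrec f g) (k # xs) (rec_nat (a ((!) xs)) (\<lambda>k r. b k r ((!) xs)) k)"
    if "length xs = n" for k xs
  proof (induction k)
    case 0
    show ?case using f[OF that] by (auto intro: rec_eval.intros)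
  next
    case (Suc k)
    show ?case
      by (rule rec_eval.intros(6)[OF Suc])
        (use g[of "k # _ # xs"] that in auto)
  qed
  \<comment> \<open>\<open>RPrec\<close> recurses on its first argument, so the counter is first
    treated as an extra argument in front; composition with \<open>m\<close> and the projections
    then removes it.\<close>
  have "computable (Suc n) (\<lambda>e. rec_nat (a (\<lambda>i. e (Suc i))) (\<lambda>k r. b k r (\<lambda>i. e (Suc i))) (e 0))"
    by (rule computableI[where r = "RPrec f g"]) (auto simp: length_Suc_conv rec)
  then obtain r where r: "\<And>xs. length xs = Suc n \<Longrightarrow> rec_eval r xs
      (rec_nat (a (\<lambda>i. xs ! Suc i)) (\<lambda>k r. b k r (\<lambda>i. xs ! Suc i)) (xs ! 0))"
    by (auto simp: computable_def)
  obtain h where h: "\<And>xs. length xs = n \<Longrightarrow> rec_eval h xs (m ((!) xs))"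
    using assms(2) by (auto simp: computable_def)
  show ?thesis
  proof (rule computableI[where r = "RComp r (h # map RProj [0..<n])"])
    fix xs :: "nat list" assume "length xs = n"
    then show "rec_eval (RComp r (h # map RProj [0..<n])) xs
        (rec_nat (a ((!) xs)) (\<lambda>k r. b k r ((!) xs)) (m ((!) xs)))"
      using r[of "m ((!) xs) # xs"] h
      by (intro rec_eval.intros(4)[where ys = "m ((!) xs) # xs"])
        (auto simp: list_all2_conv_all_nth rec_eval_proj nth_Cons split: nat.split)
  qed
qed

lemma computable_cong: "computable n f \<Longrightarrow> (\<And>e. f e = g e) \<Longrightarrow> computable n g"
  by (simp add: computable_def)

lemma computable_add [comp]:
  assumes "computable n a" "computable n b"
  shows "computable n (\<lambda>e. a e + b e)"
proof (rule computable_cong)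
  show "computable n (\<lambda>e. rec_nat (a e) (\<lambda>_ r. Suc r) (b e))"
    by (intro comp assms) simp
  have "rec_nat x (\<lambda>_ r. Suc r) N = x + N" for x N
    by (induction N) auto
  then show "rec_nat (a e) (\<lambda>_ r. Suc r) (b e) = a e + b e" for e .
qed

lemma computable_pred [comp]:
  assumes "computable n a"
  shows "computable n (\<lambda>e. a e - 1)"
proof (rule computable_cong)
  show "computable n (\<lambda>e. rec_nat 0 (\<lambda>k _. k) (a e))"
    by (intro comp assms) simp
  show "rec_nat 0 (\<lambda>k _. k) (a e) = a e - 1" for e
    by (cases "a e") auto
qed

lemma computable_if_zero:
  assumes "computable n c" "computable n a" "computable n b"
  shows "computable n (\<lambda>e. if c e = 0 then a e else b e)"
proof (rule computable_cong)
  \<comment> \<open>Case distinction is a recursion whose step ignores its counter and its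
    accumulator, so \<open>b\<close> must be shifted past these two arguments.\<close>
  have "computable (Suc (Suc n)) (\<lambda>e. b (\<lambda>i. e (Suc (Suc i))))"
  proof -
    obtain r where r: "\<And>xs. length xs = n \<Longrightarrow> rec_eval r xs (b ((!) xs))"
      using assms(3) by (auto simp: computable_def)
    have "rec_eval (RComp r (map (\<lambda>i. RProj (Suc (Suc i))) [0..<n])) (x # y # zs) (b ((!) zs))"
      if "length zs = n" for x y zs
      using that by (intro rec_eval.intros(4)[where ys = zs] r)
        (auto simp: list_all2_conv_all_nth rec_eval_proj)
    then show ?thesis
      by (intro computableI[where r = "RComp r (map (\<lambda>i. RProj (Suc (Suc i))) [0..<n])"])
        (auto simp: length_Suc_conv)
  qed
  then show "computable n (\<lambda>e. rec_nat (a e) (\<lambda>_ _. b e) (c e))"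
    by (intro comp assms)
  show "rec_nat (a e) (\<lambda>_ _. b e) (c e) = (if c e = 0 then a e else b e)" for e
    by (cases "c e") auto
qed

lemma computable_if [comp]:
  assumes "decidable n P" "computable n a" "computable n b"
  shows "computable n (\<lambda>e. if P e then a e else b e)"
proof (rule computable_cong)
  show "computable n (\<lambda>e. if (if P e then 0 else 1) = (0::nat) then a e else b e)"
    by (intro computable_if_zero assms assms(1)[unfolded decidable_def])
qed auto

text \<open>The representing function of the equality symbol is reused: the sum of the two truncated
  differences vanishes exactly on the diagonal.\<close>

lemma decidable_eq [comp]:
  assumes "computable n a" "computable n b"
  shows "decidable n (\<lambda>e. a e = b e)"
proof -
  have "computable 2 (\<lambda>e. (e 0 - e 1) + (e 1 - e 0))"
    by (rule computableI[where r = eq_rec])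
      (auto simp: numeral_2_eq_2 length_Suc_conv rec_eval_eq_rec)
  from computable_compose2[OF this assms]
  have "computable n (\<lambda>e. if (a e - b e) + (b e - a e) = 0 then 0 else 1)"
    by (rule computable_if_zero) (rule comp)+
  moreover have "(x - y) + (y - x) = 0 \<longleftrightarrow> x = y" for x y :: nat by auto
  ultimately show ?thesis by (simp add: decidable_def)
qed

lemma decidable_not [comp]:
  assumes "decidable n P" shows "decidable n (\<lambda>e. \<not> P e)"
  unfolding decidable_def
  by (rule computable_cong, rule computable_if[OF assms computable_const[of _ 1]
        computable_const[of _ 0]]) auto

lemma decidable_conj [comp]:
  assumes "decidable n P" "decidable n Q" shows "decidable n (\<lambda>e. P e \<and> Q e)"
  unfolding decidable_def
  by (rule computable_cong, rule computable_if[OF assms(1) assms(2)[unfolded decidable_def]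
        computable_const[of _ 1]]) auto

lemma decidable_disj [comp]:
  assumes "decidable n P" "decidable n Q" shows "decidable n (\<lambda>e. P e \<or> Q e)"
  unfolding decidable_def
  by (rule computable_cong, rule computable_if[OF assms(1) computable_const[of _ 0]
        assms(2)[unfolded decidable_def]]) auto

lemma decidable_const [comp]: "decidable n (\<lambda>_. c)"
  unfolding decidable_def by (rule comp)

lemma decidable_Bex_list:
  "(\<And>x. x \<in> set xs \<Longrightarrow> decidable n (P x)) \<Longrightarrow> decidable n (\<lambda>e. \<exists>x\<in>set xs. P x e)"
  by (induction xs) (auto intro!: comp)

lemma decidable_Ball_list:
  "(\<And>x. x \<in> set xs \<Longrightarrow> decidable n (P x)) \<Longrightarrow> decidable n (\<lambda>e. \<forall>x\<in>set xs. P x e)"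
  by (induction xs) (auto intro!: comp)

text \<open>Makes room for a dummy argument in second place: in the recursion for bounded
  quantifiers the accumulator sits between the bound variable and the environment.\<close>

lemma computable_weaken:
  assumes "computable (Suc n) (\<lambda>e. b (e 0) (\<lambda>i. e (Suc i)))"
  shows "computable (Suc (Suc n)) (\<lambda>e. b (e 0) (\<lambda>i. e (Suc (Suc i))))"
proof -
  obtain r where r: "\<And>xs. length xs = Suc n \<Longrightarrow> rec_eval r xs (b (xs ! 0) (\<lambda>i. xs ! Suc i))"
    using assms by (auto simp: computable_def)
  show ?thesis
  proof (rule computableI[where r = "RComp r (RProj 0 # map (\<lambda>i. RProj (Suc (Suc i))) [0..<n])"])
    fix xs :: "nat list" assume len: "length xs = Suc (Suc n)"
    then obtain x y zs where xs: "xs = x # y # zs" "length zs = n" by (auto simp: length_Suc_conv)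
    show "rec_eval (RComp r (RProj 0 # map (\<lambda>i. RProj (Suc (Suc i))) [0..<n])) xs
        (b (xs ! 0) (\<lambda>i. xs ! Suc (Suc i)))"
      using r[of "x # zs"] xs
      by (intro rec_eval.intros(4)[where ys = "x # zs"])
        (auto simp: list_all2_conv_all_nth rec_eval_proj nth_Cons split: nat.split)
  qed
qed

lemma decidable_bex [comp]:
  assumes "computable n m" "decidable (Suc n) (\<lambda>e. P (e 0) (\<lambda>i. e (Suc i)))"
  shows "decidable n (\<lambda>e. \<exists>k<m e. P k e)"
  unfolding decidable_def
proof (rule computable_cong)
  have "decidable (Suc (Suc n)) (\<lambda>e. P (e 0) (\<lambda>i. e (Suc (Suc i))))"
    using computable_weaken[of n "\<lambda>k e. if P k e then 0 else 1"] assms(2)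
    by (simp add: decidable_def)
  then show "computable n (\<lambda>e. rec_nat 1 (\<lambda>k r. if P k e then 0 else r) (m e))"
    by (intro comp assms) simp_all
  \<comment> \<open>The accumulator is a truth value in the convention of \<open>decidable\<close>:
    it starts at 1 (false) and drops to 0 at the first hit.\<close>
  have "rec_nat 1 (\<lambda>k r. if P k e then 0 else r) N = (if \<exists>k<N. P k e then 0 else 1)" for e N
    by (induction N) (auto simp: less_Suc_eq)
  then show "rec_nat 1 (\<lambda>k r. if P k e then 0 else r) (m e) = (if \<exists>k<m e. P k e then 0 else 1)" for e .
qed

lemma decidable_ball [comp]:
  assumes "computable n m" "decidable (Suc n) (\<lambda>e. P (e 0) (\<lambda>i. e (Suc i)))"
  shows "decidable n (\<lambda>e. \<forall>k<m e. P k e)"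
  using decidable_not[OF decidable_bex[OF assms(1) decidable_not[OF assms(2)]]] by simp

text \<open>Decidability supplies a total test, so all values below the least solution are defined
  and positive, as \<open>RMin\<close> demands. The searched variable comes first because
  \<open>RMin\<close> puts it in front.\<close>

lemma recursive_search:
  assumes "decidable 2 (\<lambda>e. P (e 0) (e 1))"
  obtains p where "\<And>x. \<exists>z. P z x \<Longrightarrow> \<exists>z. rec_eval p [x] z \<and> P z x"
proof -
  obtain r where r: "\<And>xs. length xs = 2 \<Longrightarrow> rec_eval r xs (if P (xs ! 0) (xs ! 1) then 0 else 1)"
    using assms by (auto simp: computable_def decidable_def)
  have r: "rec_eval r [z, x] (if P z x then 0 else 1)" for z x
    using r[of "[z, x]"] by simp
  show ?thesis
  proof (rule that[of "RMin r"])
    fix x assume ex: "\<exists>z. P z x"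
    define z where "z = (LEAST z. P z x)"
    have z: "P z x" using ex unfolding z_def by (rule LeastI_ex)
    have less: "\<not> P y x" if "y < z" for y using that not_less_Least unfolding z_def by blast
    have "rec_eval (RMin r) [x] z"
    proof (rule rec_eval.intros(7))
      show "rec_eval r [z, x] 0" using r[of z x] z by simp
      show "\<exists>w>0. rec_eval r [y, x] w" if "y < z" for y
        using r[of y x] less[OF that] by (intro exI[of _ 1]) simp
    qed
    with z show "\<exists>z. rec_eval (RMin r) [x] z \<and> P z x" by blast
  qed
qed

section \<open>Computability of pairing and of list operations on codes\<close>

lemma computable_prod_encode [comp]:
  assumes "computable n a" "computable n b"
  shows "computable n (\<lambda>e. prod_encode (a e, b e))"
proof -
  have tri: "computable n (\<lambda>e. triangle (a e))" if "computable n a" for a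
  proof (rule computable_cong)
    show "computable n (\<lambda>e. rec_nat 0 (\<lambda>k r. r + Suc k) (a e))" by (intro comp that) auto
    have "rec_nat 0 (\<lambda>k r. r + Suc k) N = triangle N" for N
      by (induction N) auto
    then show "rec_nat 0 (\<lambda>k r. r + Suc k) (a e) = triangle (a e)" for e .
  qed
  show ?thesis unfolding prod_encode_def by (auto intro!: comp tri assms)
qed

text \<open>Neither component of a pair exceeds its code, so each is found by a search up to the
  code. Uniqueness of the component makes the last hit kept by the recursion the right one.\<close>

lemma computable_prod_decode:
  shows computable_fst [comp]: "computable n a \<Longrightarrow> computable n (\<lambda>e. fst (prod_decode (a e)))"
    and computable_snd [comp]: "computable n a \<Longrightarrow> computable n (\<lambda>e. snd (prod_decode (a e)))"
proof -
  define f where "f z N = rec_nat 0 (\<lambda>k r. if \<exists>b<Suc z. z = prod_encode (k, b) then k else r) N" for z N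
  define g where "g z N = rec_nat 0 (\<lambda>k r. if \<exists>b<Suc z. z = prod_encode (b, k) then k else r) N" for z N
  have f: "f (prod_encode (x, y)) N = x" if "x < N" for x y N
    using that le_prod_encode_2[of y x] by (induction N) (auto simp: f_def less_Suc_eq less_Suc_eq_le)
  have g: "g (prod_encode (x, y)) N = y" if "y < N" for x y N
    using that le_prod_encode_1[of x y] by (induction N) (auto simp: g_def less_Suc_eq less_Suc_eq_le)
  have fst: "f z (Suc z) = fst (prod_decode z)" for z
    using f[of "fst (prod_decode z)" "Suc z" "snd (prod_decode z)"]
      le_prod_encode_1[of "fst (prod_decode z)" "snd (prod_decode z)"] by simp
  have snd: "g z (Suc z) = snd (prod_decode z)" for z
    using g[of "snd (prod_decode z)" "Suc z" "fst (prod_decode z)"]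
      le_prod_encode_2[of "snd (prod_decode z)" "fst (prod_decode z)"] by simp
  have "computable 1 (\<lambda>e. f (e 0) (Suc (e 0)))" unfolding f_def by (intro comp) auto
  then show "computable n a \<Longrightarrow> computable n (\<lambda>e. fst (prod_decode (a e)))"
    unfolding fst by (rule computable_compose1)
  have "computable 1 (\<lambda>e. g (e 0) (Suc (e 0)))" unfolding g_def by (intro comp) auto
  then show "computable n a \<Longrightarrow> computable n (\<lambda>e. snd (prod_decode (a e)))"
    unfolding snd by (rule computable_compose1)
qed

definition code_drop :: "nat \<Rightarrow> nat \<Rightarrow> nat" where
  "code_drop k z = rec_nat z (\<lambda>_ r. snd (prod_decode (r - 1))) k"

definition code_hd :: "nat \<Rightarrow> nat" where
  "code_hd z = fst (prod_decode (z - 1))"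

lemma computable_code_drop [comp]:
  "computable n a \<Longrightarrow> computable n b \<Longrightarrow> computable n (\<lambda>e. code_drop (a e) (b e))"
  unfolding code_drop_def by (intro comp) auto

lemma computable_code_hd [comp]: "computable n a \<Longrightarrow> computable n (\<lambda>e. code_hd (a e))"
  unfolding code_hd_def by (intro comp)

text \<open>Since also \<open>0 - 1 = 0\<close>, the code 0 of the empty list is a fixed point of
  the tail step: dropping beyond the end stays at 0.\<close>

lemma prod_decode_0 [simp]: "prod_decode 0 = (0, 0)"
  using prod_encode_inverse[of "(0, 0)"] by (simp add: prod_encode_def)

lemma code_drop_eq [simp]: "code_drop k (list_encode xs) = list_encode (drop k xs)"
proof (induction k)
  case (Suc k)
  have "drop (Suc k) xs = tl (drop k xs)" by (simp add: drop_Suc tl_drop)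
  with Suc show ?case by (cases "drop k xs") (simp_all add: code_drop_def)
qed (simp add: code_drop_def)

text \<open>Lets the code of a list serve as the bound of a quantifier over its positions.\<close>

lemma length_le_list_encode: "length xs \<le> list_encode xs"
proof (induction xs)
  case (Cons x xs)
  then show ?case using le_prod_encode_2[of "list_encode xs" x] by simp
qed simp

section \<open>Horn clauses over the natural numbers\<close>

datatype hterm = HV nat | HN nat | HS hterm | HP hterm hterm

primrec hval :: "(nat \<Rightarrow> nat) \<Rightarrow> hterm \<Rightarrow> nat" where
  "hval \<rho> (HV i) = \<rho> i"
| "hval \<rho> (HN n) = n"
| "hval \<rho> (HS t) = Suc (hval \<rho> t)"
| "hval \<rho> (HP s t) = prod_encode (hval \<rho> s, hval \<rho> t)"

primrec hbound :: "hterm \<Rightarrow> nat" where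
  "hbound (HV i) = Suc i"
| "hbound (HN n) = 0"
| "hbound (HS t) = hbound t"
| "hbound (HP s t) = max (hbound s) (hbound t)"

text \<open>Mirrors \<open>list_encode\<close>, where a nonempty list is the successor of a
  pair.\<close>

primrec hlist :: "hterm list \<Rightarrow> hterm" where
  "hlist [] = HN 0"
| "hlist (t # ts) = HS (HP t (hlist ts))"

definition atom_code :: "nat \<Rightarrow> nat list \<Rightarrow> nat" where
  "atom_code q xs = prod_encode (q, list_encode xs)"

definition hatom :: "nat \<Rightarrow> hterm list \<Rightarrow> hterm" where
  "hatom q ts = HP (HN q) (hlist ts)"

lemma hval_hlist: "hval \<rho> (hlist ts) = list_encode (map (hval \<rho>) ts)"
  by (induction ts) auto

lemma hval_hatom [simp]: "hval \<rho> (hatom q ts) = atom_code q (map (hval \<rho>) ts)"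
  by (simp add: hatom_def atom_code_def hval_hlist)

type_synonym hclause = "hterm list \<times> hterm"

inductive derivable :: "hclause list \<Rightarrow> nat \<Rightarrow> bool" for cls where
  "(ps, c) \<in> set cls \<Longrightarrow> (\<And>p. p \<in> set ps \<Longrightarrow> derivable cls (hval \<rho> p)) \<Longrightarrow> derivable cls (hval \<rho> c)"

definition horn_step :: "hclause list \<Rightarrow> nat set \<Rightarrow> nat \<Rightarrow> bool" where
  "horn_step cls X x \<longleftrightarrow>
     (\<exists>(ps, c)\<in>set cls. \<exists>\<rho>. x = hval \<rho> c \<and> (\<forall>p\<in>set ps. hval \<rho> p \<in> X))"

text \<open>The newest fact stands in front, so the facts available to a step are a tail of the
  list, and tails are computable on codes by \<open>code_drop\<close>.\<close>

definition derivation :: "hclause list \<Rightarrow> nat list \<Rightarrow> bool" where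
  "derivation cls fs \<longleftrightarrow> (\<forall>k<length fs. horn_step cls (set (drop (Suc k) fs)) (fs ! k))"

lemma horn_step_mono: "horn_step cls X x \<Longrightarrow> X \<subseteq> Y \<Longrightarrow> horn_step cls Y x"
  unfolding horn_step_def by fast

lemma derivation_Nil: "derivation cls []"
  by (simp add: derivation_def)

lemma derivation_Cons: "derivation cls (x # fs) \<longleftrightarrow> horn_step cls (set fs) x \<and> derivation cls fs"
  by (auto simp: derivation_def less_Suc_eq_0_disj)

lemma derivation_append: "derivation cls fs \<Longrightarrow> derivation cls gs \<Longrightarrow> derivation cls (fs @ gs)"
  by (induction fs) (auto simp: derivation_Cons elim: horn_step_mono)

lemma derivation_sound: "derivation cls fs \<Longrightarrow> x \<in> set fs \<Longrightarrow> derivable cls x"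
proof (induction fs arbitrary: x)
  case (Cons y fs)
  then have "\<forall>x\<in>set fs. derivable cls x" by (simp add: derivation_Cons)
  moreover obtain ps c \<rho> where "(ps, c) \<in> set cls" "y = hval \<rho> c" "\<forall>p\<in>set ps. hval \<rho> p \<in> set fs"
    using Cons.prems(1) by (auto simp: derivation_Cons horn_step_def)
  ultimately show ?case using Cons.prems(2) by (auto intro: derivable.intros)
qed simp

lemma derivation_complete: "derivable cls x \<Longrightarrow> \<exists>fs. derivation cls fs \<and> x \<in> set fs"
proof (induction rule: derivable.induct)
  case (1 ps c \<rho>)
  \<comment> \<open>Each premise comes with its own derivation. Collecting them premise by premise
    works because concatenation only enlarges the sets of available facts.\<close>
  have "\<exists>fs. derivation cls fs \<and> (\<forall>p\<in>set qs. hval \<rho> p \<in> set fs)" if "set qs \<subseteq> set ps" for qs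
    using that
  proof (induction qs)
    case Nil
    show ?case using derivation_Nil by auto
  next
    case (Cons q qs)
    then obtain fs where "derivation cls fs" "\<forall>p\<in>set qs. hval \<rho> p \<in> set fs" by auto
    moreover obtain gs where "derivation cls gs" "hval \<rho> q \<in> set gs"
      using 1(3)[of q] Cons.prems by auto
    ultimately show ?case by (auto intro!: exI[of _ "fs @ gs"] derivation_append)
  qed
  then obtain fs where fs: "derivation cls fs" "\<forall>p\<in>set ps. hval \<rho> p \<in> set fs" by blast
  then have "derivation cls (hval \<rho> c # fs)"
    using 1(1) by (auto simp: derivation_Cons horn_step_def)
  then show ?case by (intro exI[of _ "hval \<rho> c # fs"]) simp
qed

section \<open>Decidable checking of coded derivations\<close>

definition code_nth :: "nat \<Rightarrow> nat \<Rightarrow> nat" where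
  "code_nth z i = code_hd (code_drop i z)"

text \<open>The test for 0 excludes positions beyond the end, where \<open>code_hd\<close> would
  yield a spurious member 0.\<close>

definition code_mem :: "nat \<Rightarrow> nat \<Rightarrow> bool" where
  "code_mem x z \<longleftrightarrow> (\<exists>j<z. code_drop j z \<noteq> 0 \<and> code_hd (code_drop j z) = x)"

lemma list_encode_eq_0 [simp]: "list_encode xs = 0 \<longleftrightarrow> xs = []"
  by (cases xs) auto

lemma code_nth_list_encode: "i < length xs \<Longrightarrow> code_nth (list_encode xs) i = xs ! i"
  by (simp add: code_nth_def code_hd_def flip: Cons_nth_drop_Suc)

lemma code_hd_drop: "k < length xs \<Longrightarrow> code_hd (list_encode (drop k xs)) = xs ! k"
  using code_nth_list_encode by (simp add: code_nth_def)

lemma code_mem_list_encode [simp]: "code_mem x (list_encode xs) \<longleftrightarrow> x \<in> set xs"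
proof
  assume "x \<in> set xs"
  then obtain j where "j < length xs" "xs ! j = x" by (auto simp: in_set_conv_nth)
  then show "code_mem x (list_encode xs)"
    using length_le_list_encode[of xs] unfolding code_mem_def
    by (intro exI[of _ j]) (simp add: code_hd_drop)
qed (auto simp: code_mem_def in_set_conv_nth code_hd_drop not_le)

text \<open>The assignment of the clause variables is the only infinite choice in a step. Bounding
  its code by \<open>w\<close> makes the step decidable, and a larger \<open>w\<close> loses
  nothing.\<close>

definition horn_step_code :: "hclause list \<Rightarrow> nat \<Rightarrow> nat \<Rightarrow> nat \<Rightarrow> bool" where
  "horn_step_code cls w z x \<longleftrightarrow>
     (\<exists>cl\<in>set cls. \<exists>\<rho><w. x = hval (code_nth \<rho>) (snd cl) \<and>
        (\<forall>p\<in>set (fst cl). code_mem (hval (code_nth \<rho>) p) z))"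

definition derivation_code :: "hclause list \<Rightarrow> nat \<Rightarrow> nat \<Rightarrow> bool" where
  "derivation_code cls w z \<longleftrightarrow>
     (\<forall>k<z. code_drop k z = 0 \<or> horn_step_code cls w (code_drop (Suc k) z) (code_nth z k))"

lemma derivation_code_list_encode:
  "derivation_code cls w (list_encode fs) \<longleftrightarrow>
     (\<forall>k<length fs. horn_step_code cls w (list_encode (drop (Suc k) fs)) (fs ! k))"
proof -
  have "horn_step_code cls w (list_encode (drop (Suc k) fs)) (fs ! k) \<longleftrightarrow>
      horn_step_code cls w (code_drop (Suc k) (list_encode fs)) (code_nth (list_encode fs) k)"
    if "k < length fs" for k
    using that by (simp add: code_nth_list_encode)
  moreover have "code_drop k (list_encode fs) = 0 \<longleftrightarrow> \<not> k < length fs" for k by auto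
  moreover have "k < list_encode fs" if "k < length fs" for k
    using that length_le_list_encode[of fs] by simp
  ultimately show ?thesis unfolding derivation_code_def by blast
qed

text \<open>A term sees only the variables below its \<open>hbound\<close>, so a finite prefix of an
  assignment, which has a code, can replace it.\<close>

lemma hval_code_nth:
  "hbound t \<le> n \<Longrightarrow> hval (code_nth (list_encode (map \<rho> [0..<n]))) t = hval \<rho> t"
  by (induction t) (auto simp: code_nth_list_encode)

lemma horn_step_iff_code:
  "horn_step cls (set fs) x \<longleftrightarrow> (\<exists>w. horn_step_code cls w (list_encode fs) x)"
proof
  assume "horn_step cls (set fs) x"
  then obtain ps c \<rho> where c: "(ps, c) \<in> set cls" "x = hval \<rho> c" "\<forall>p\<in>set ps. hval \<rho> p \<in> set fs"
    by (auto simp: horn_step_def)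
  define n where "n = Max (insert (hbound c) (hbound ` set ps))"
  have "\<forall>t\<in>insert c (set ps). hbound t \<le> n" by (auto simp: n_def)
  then have "\<forall>t\<in>insert c (set ps). hval (code_nth (list_encode (map \<rho> [0..<n]))) t = hval \<rho> t"
    by (simp add: hval_code_nth)
  with c have "horn_step_code cls (Suc (list_encode (map \<rho> [0..<n]))) (list_encode fs) x"
    unfolding horn_step_code_def
    by (intro bexI[of _ "(ps, c)"] exI[of _ "list_encode (map \<rho> [0..<n])"]) auto
  then show "\<exists>w. horn_step_code cls w (list_encode fs) x" ..
next
  assume "\<exists>w. horn_step_code cls w (list_encode fs) x"
  then obtain ps c \<rho> where "(ps, c) \<in> set cls" "x = hval (code_nth \<rho>) c"
    "\<forall>p\<in>set ps. hval (code_nth \<rho>) p \<in> set fs"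
    by (auto simp: horn_step_code_def)
  then show "horn_step cls (set fs) x"
    unfolding horn_step_def by blast
qed

lemma horn_step_code_mono: "horn_step_code cls w z x \<Longrightarrow> w \<le> w' \<Longrightarrow> horn_step_code cls w' z x"
  unfolding horn_step_code_def by (blast intro: order.strict_trans2)

text \<open>Every step has a bound of its own; by monotonicity the maximum over the finitely many
  steps serves them all.\<close>

lemma derivation_iff_code: "derivation cls fs \<longleftrightarrow> (\<exists>w. derivation_code cls w (list_encode fs))"
proof
  assume "derivation cls fs"
  then have "\<forall>k<length fs. \<exists>w. horn_step_code cls w (list_encode (drop (Suc k) fs)) (fs ! k)"
    unfolding derivation_def horn_step_iff_code .
  then obtain w where
    w: "\<forall>k<length fs. horn_step_code cls (w k) (list_encode (drop (Suc k) fs)) (fs ! k)"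
    by (auto dest!: choice simp flip: all_conj_distrib ex_simps)
  have "w k \<le> Max (w ` {..<length fs})" if "k < length fs" for k
    using that by (intro Max_ge) auto
  with w have "derivation_code cls (Max (w ` {..<length fs})) (list_encode fs)"
    unfolding derivation_code_list_encode by (blast intro: horn_step_code_mono)
  then show "\<exists>w. derivation_code cls w (list_encode fs)" ..
next
  assume "\<exists>w. derivation_code cls w (list_encode fs)"
  then show "derivation cls fs"
    unfolding derivation_code_list_encode derivation_def horn_step_iff_code by blast
qed

lemma computable_code_nth [comp]:
  "computable n a \<Longrightarrow> computable n b \<Longrightarrow> computable n (\<lambda>e. code_nth (a e) (b e))"
  unfolding code_nth_def by (intro comp)

lemma computable_hval [comp]:
  "computable n a \<Longrightarrow> computable n (\<lambda>e. hval (code_nth (a e)) t)"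
  by (induction t) (auto intro!: comp)

lemma decidable_compose2:
  assumes "decidable 2 (\<lambda>e. P (e 0) (e 1))" "computable n a" "computable n b"
  shows "decidable n (\<lambda>e. P (a e) (b e))"
  using computable_compose2[of "\<lambda>x y. if P x y then 0 else 1"] assms
  by (simp add: decidable_def)

lemma computable_compose3:
  assumes "computable 3 (\<lambda>e. h (e 0) (e 1) (e 2))" "computable n a" "computable n b" "computable n c"
  shows "computable n (\<lambda>e. h (a e) (b e) (c e))"
  using computable_compose[of "[a, b, c]" "\<lambda>e. h (e 0) (e 1) (e 2)" n] assms
  by (auto simp: numeral_2_eq_2 numeral_3_eq_3)

lemma decidable_compose3:
  assumes "decidable 3 (\<lambda>e. P (e 0) (e 1) (e 2))" "computable n a" "computable n b" "computable n c"
  shows "decidable n (\<lambda>e. P (a e) (b e) (c e))"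
  using computable_compose3[of "\<lambda>x y z. if P x y z then 0 else 1"] assms
  by (simp add: decidable_def)

lemma decidable_code_mem [comp]:
  assumes "computable n a" "computable n b"
  shows "decidable n (\<lambda>e. code_mem (a e) (b e))"
proof (rule decidable_compose2[OF _ assms])
  show "decidable 2 (\<lambda>e. code_mem (e 0) (e 1))"
    unfolding code_mem_def by (intro comp) auto
qed

lemma decidable_horn_step_code [comp]:
  assumes "computable n a" "computable n b" "computable n c"
  shows "decidable n (\<lambda>e. horn_step_code cls (a e) (b e) (c e))"
proof (rule decidable_compose3[OF _ assms])
  show "decidable 3 (\<lambda>e. horn_step_code cls (e 0) (e 1) (e 2))"
    unfolding horn_step_code_def
    by (intro decidable_Bex_list decidable_Ball_list comp) auto
qed

lemma decidable_derivation_code [comp]: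
  assumes "computable n a" "computable n b"
  shows "decidable n (\<lambda>e. derivation_code cls (a e) (b e))"
proof (rule decidable_compose2[OF _ assms])
  show "decidable 2 (\<lambda>e. derivation_code cls (e 0) (e 1))"
    unfolding derivation_code_def by (intro comp) auto
qed

text \<open>The search runs over codes of a value, a derivation and a bound on the codes of the variable
  assignments in the derivation.\<close>

theorem derivable_search:
  obtains p where "\<And>x. \<exists>y. derivable cls (atom_code q [x, y]) \<Longrightarrow>
    \<exists>y. rec_eval p [x] y \<and> derivable cls (atom_code q [x, y])"
proof -
  define val where "val z = fst (prod_decode z)" for z
  define deriv where "deriv z = fst (prod_decode (snd (prod_decode z)))" for z
  define bnd where "bnd z = snd (prod_decode (snd (prod_decode z)))" for z
  define P where "P z x \<longleftrightarrow> derivation_code cls (bnd z) (deriv z) \<and>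
    code_mem (atom_code q [x, val z]) (deriv z)" for z x
  have "decidable 2 (\<lambda>e. P (e 0) (e 1))"
    unfolding P_def val_def deriv_def bnd_def atom_code_def list_encode.simps by (intro comp) auto
  then obtain p where p: "\<And>x. \<exists>z. P z x \<Longrightarrow> \<exists>z. rec_eval p [x] z \<and> P z x"
    by (rule recursive_search) blast
  have "computable 1 (\<lambda>e. val (e 0))" unfolding val_def by (intro comp) auto
  then obtain v where v: "\<And>xs. length xs = 1 \<Longrightarrow> rec_eval v xs (val (xs ! 0))"
    by (auto simp: computable_def)
  \<comment> \<open>Every number is the code of some list, so whatever the search finds decodes to a
    genuine derivation.\<close>
  have P_der: "derivable cls (atom_code q [x, val z])" if "P z x" for z x
    using that derivation_sound[of cls "list_decode (deriv z)"]
      derivation_iff_code[of cls "list_decode (deriv z)"]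
      code_mem_list_encode[of _ "list_decode (deriv z)"]
    by (auto simp: P_def)
  have der_P: "\<exists>z. P z x" if der: "derivable cls (atom_code q [x, y])" for x y
  proof -
    obtain fs where fs: "derivation cls fs" "atom_code q [x, y] \<in> set fs"
      using derivation_complete[OF der] by blast
    then obtain w where "derivation_code cls w (list_encode fs)" by (auto simp: derivation_iff_code)
    with fs have "P (prod_encode (y, prod_encode (list_encode fs, w))) x"
      by (simp add: P_def val_def deriv_def bnd_def)
    then show ?thesis ..
  qed
  show ?thesis
  proof (rule that[of "RComp v [p]"])
    fix x assume "\<exists>y. derivable cls (atom_code q [x, y])"
    with der_P p obtain z where z: "rec_eval p [x] z" "P z x" by blast
    have "rec_eval (RComp v [p]) [x] (val z)"
      using z(1) v[of "[z]"] by (intro rec_eval.intros(4)[where ys = "[z]"]) auto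
    with P_der[OF z(2)]
    show "\<exists>y. rec_eval (RComp v [p]) [x] y \<and> derivable cls (atom_code q [x, y])"
      by blast
  qed
qed

section \<open>Clauses for evaluation and correctness\<close>

text \<open>The relation symbols start at \<open>2\<close> because the simplifier rewrites the numeral \<open>1\<close> to \<open>Suc 0\<close>.\<close>

abbreviation (input) Nth :: nat where "Nth \<equiv> 2"
abbreviation (input) Neq :: nat where "Neq \<equiv> 3"
abbreviation (input) Fresh :: nat where "Fresh \<equiv> 4"
abbreviation (input) Len :: nat where "Len \<equiv> 5"
abbreviation (input) Ev :: nat where "Ev \<equiv> 6"
abbreviation (input) Evs :: nat where "Evs \<equiv> 7"
abbreviation (input) Numl :: nat where "Numl \<equiv> 8"
abbreviation (input) Nums :: nat where "Nums \<equiv> 9"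
abbreviation (input) Val :: nat where "Val \<equiv> 10"
abbreviation (input) Vals :: nat where "Vals \<equiv> 11"
abbreviation (input) Sat :: nat where "Sat \<equiv> 12"
abbreviation (input) Unsat :: nat where "Unsat \<equiv> 13"
abbreviation (input) Below :: nat where "Below \<equiv> 14"
abbreviation (input) OccF :: nat where "OccF \<equiv> 15"
abbreviation (input) OccT :: nat where "OccT \<equiv> 16"
abbreviation (input) Corr :: nat where "Corr \<equiv> 17"
abbreviation (input) Solv :: nat where "Solv \<equiv> 18"
abbreviation (input) Main :: nat where "Main \<equiv> 19"

abbreviation (input) hcons :: "hterm \<Rightarrow> hterm \<Rightarrow> hterm" where "hcons s t \<equiv> HS (HP s t)"

text \<open>\<open>Val\<close>, \<open>Sat\<close> and \<open>Unsat\<close> take a code of a substitution, a list of values for the variables, and a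
  code of a term or formula. Only table entries that are present are ever consulted, so no clause
  expresses that an entry is missing; a successful table lists the value \<open>?\<close> explicitly.
  \<open>OccF\<close> and \<open>OccT\<close> generate the formulas and terms hereditarily occurring in the critical formulas,
  including those inside the names of Skolem functions. They stand in for the test that a term is
  canonical, since \<open>L_fm\<close> is inherited by these occurrences.\<close>

definition list_clauses :: "hclause list" where
  "list_clauses = (let i = HV 0; k = HV 1; l = HV 2; m = HV 3; n = HV 4; x = HV 5; y = HV 6 in
    [([], hatom Nth [hcons x l, HN 0, x]),
     ([hatom Nth [l, i, x]], hatom Nth [hcons y l, HS i, x]),
     ([], hatom Neq [HN 0, HS n]),
     ([], hatom Neq [HS m, HN 0]),
     ([hatom Neq [m, n]], hatom Neq [HS m, HS n]),
     ([], hatom Fresh [x, HN 0]),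
     ([hatom Neq [x, y], hatom Fresh [x, l]], hatom Fresh [x, hcons (HP y n) l]),
     ([], hatom Len [HN 0, HN 0]),
     ([hatom Len [l, k]], hatom Len [hcons x l, hcons y k])])"

text \<open>The tags 0 to 4 are those of \<open>recf_code\<close>. They cover the primitive
  recursive definitions, the only ones that \<open>L_fm\<close> admits in atoms.\<close>

definition ev_clauses :: "hclause list" where
  "ev_clauses = (let f = HV 0; g = HV 1; i = HV 2; k = HV 3; l = HV 4; n = HV 5; x = HV 6; y = HV 7 in
    [([], hatom Ev [HP (HN 0) (HN 0), l, HN 0]),
     ([], hatom Ev [HP (HN 1) (HN 0), hcons x (HN 0), HS x]),
     ([hatom Nth [l, i, x]], hatom Ev [HP (HN 2) i, l, x]),
     ([hatom Evs [g, l, k], hatom Ev [f, k, x]], hatom Ev [HP (HN 3) (HP f g), l, x]),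
     ([hatom Ev [f, l, x]], hatom Ev [HP (HN 4) (HP f g), hcons (HN 0) l, x]),
     ([hatom Ev [HP (HN 4) (HP f g), hcons n l, y], hatom Ev [g, hcons n (hcons y l), x]],
        hatom Ev [HP (HN 4) (HP f g), hcons (HS n) l, x]),
     ([], hatom Evs [HN 0, l, HN 0]),
     ([hatom Ev [f, l, x], hatom Evs [g, l, k]], hatom Evs [hcons f g, l, hcons x k])])"

definition num_clauses :: "hclause list" where
  "num_clauses = (let k = HV 0; l = HV 1; n = HV 2; x = HV 3 in
    [([], hatom Numl [HN 0, HP (HN 1) (HN 0)]),
     ([hatom Numl [n, x]], hatom Numl [HS n, HP (HN 2) x]),
     ([], hatom Nums [HN 0, HN 0]),
     ([hatom Numl [n, x], hatom Nums [l, k]], hatom Nums [hcons n l, hcons x k])])"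

text \<open>Argument values are turned back into numerals before the lookup, since the table is
  keyed by codes of canonical terms. In an entry, 0 codes \<open>?\<close>, which evaluates to 0,
  and \<open>Suc n\<close> codes the numeral for \<open>n\<close>.\<close>

definition val_clauses :: "hclause list" where
  "val_clauses = (let f = HV 0; g = HV 1; i = HV 2; k = HV 3; l = HV 4; n = HV 5; s = HV 6;
      x = HV 7; y = HV 8 in
    [([hatom Nth [l, i, n]], hatom Val [s, l, HP (HN 0) i, n]),
     ([], hatom Val [s, l, HP (HN 1) (HN 0), HN 0]),
     ([hatom Val [s, l, x, n]], hatom Val [s, l, HP (HN 2) x, HS n]),
     ([hatom Vals [s, l, g, k], hatom Nums [k, y],
        hatom Nth [s, i, HP (HP (HN 3) (HP f y)) (HN 0)]],
        hatom Val [s, l, HP (HN 3) (HP f g), HN 0]),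
     ([hatom Vals [s, l, g, k], hatom Nums [k, y],
        hatom Nth [s, i, HP (HP (HN 3) (HP f y)) (HS n)]],
        hatom Val [s, l, HP (HN 3) (HP f g), n]),
     ([], hatom Vals [s, l, HN 0, HN 0]),
     ([hatom Val [s, l, x, n], hatom Vals [s, l, g, k]], hatom Vals [s, l, hcons x g, hcons n k])])"

definition sat_clauses :: "hclause list" where
  "sat_clauses = (let f = HV 0; g = HV 1; k = HV 2; l = HV 3; n = HV 4; s = HV 5; x = HV 6; y = HV 7 in
    [([hatom Vals [s, l, g, k], hatom Ev [f, k, HN 0]], hatom Sat [s, l, HP (HN 0) (HP f g)]),
     ([hatom Unsat [s, l, x]], hatom Sat [s, l, HP (HN 1) x]),
     ([hatom Sat [s, l, x], hatom Sat [s, l, y]], hatom Sat [s, l, HP (HN 2) (HP x y)]),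
     ([hatom Sat [s, l, x]], hatom Sat [s, l, HP (HN 3) (HP x y)]),
     ([hatom Sat [s, l, y]], hatom Sat [s, l, HP (HN 3) (HP x y)]),
     ([hatom Vals [s, l, g, k], hatom Ev [f, k, HS n]], hatom Unsat [s, l, HP (HN 0) (HP f g)]),
     ([hatom Sat [s, l, x]], hatom Unsat [s, l, HP (HN 1) x]),
     ([hatom Unsat [s, l, x]], hatom Unsat [s, l, HP (HN 2) (HP x y)]),
     ([hatom Unsat [s, l, y]], hatom Unsat [s, l, HP (HN 2) (HP x y)]),
     ([hatom Unsat [s, l, x], hatom Unsat [s, l, y]], hatom Unsat [s, l, HP (HN 3) (HP x y)]),
     ([], hatom Below [s, l, x, HN 0]),
     ([hatom Below [s, l, x, n], hatom Unsat [s, hcons n l, x]], hatom Below [s, l, x, HS n])])"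

definition occ_clauses :: "hclause list" where
  "occ_clauses = (let f = HV 0; g = HV 1; i = HV 2; s = HV 3; x = HV 4; y = HV 5 in
    [([hatom Nth [s, i, x]], hatom OccF [s, x]),
     ([hatom OccF [s, HP (HN 1) x]], hatom OccF [s, x]),
     ([hatom OccF [s, HP (HN 2) (HP x y)]], hatom OccF [s, x]),
     ([hatom OccF [s, HP (HN 2) (HP x y)]], hatom OccF [s, y]),
     ([hatom OccF [s, HP (HN 3) (HP x y)]], hatom OccF [s, x]),
     ([hatom OccF [s, HP (HN 3) (HP x y)]], hatom OccF [s, y]),
     ([hatom OccT [s, HP (HN 3) (HP f g)]], hatom OccF [s, f]),
     ([hatom OccF [s, HP (HN 0) (HP f g)], hatom Nth [g, i, x]], hatom OccT [s, x]),
     ([hatom OccT [s, HP (HN 2) x]], hatom OccT [s, x]),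
     ([hatom OccT [s, HP (HN 3) (HP f g)], hatom Nth [g, i, x]], hatom OccT [s, x])])"

text \<open>In \<open>Corr\<close> the third argument is the part of the table already examined,
  while values are checked against the whole table \<open>s\<close>; the last clause closes the loop
  with \<open>Corr [c, s, s]\<close>. An occurring term provides the Skolem function and its arity
  through \<open>Len\<close>, but the numeral arguments of an entry are arbitrary.\<close>

definition corr_clauses :: "hclause list" where
  "corr_clauses = (let c = HV 0; f = HV 1; g = HV 2; k = HV 3; l = HV 4; n = HV 5; s = HV 6;
      x = HV 7; y = HV 8 in
    [([], hatom Corr [c, s, HN 0]),
     ([hatom Corr [c, s, l], hatom Fresh [HP (HN 3) (HP f y), l],
        hatom OccT [c, HP (HN 3) (HP f g)], hatom Len [g, k], hatom Nums [k, y]],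
        hatom Corr [c, s, hcons (HP (HP (HN 3) (HP f y)) (HN 0)) l]),
     ([hatom Corr [c, s, l], hatom Fresh [HP (HN 3) (HP f y), l],
        hatom OccT [c, HP (HN 3) (HP f g)], hatom Len [g, k], hatom Nums [k, y],
        hatom Sat [s, hcons n k, f], hatom Below [s, k, f, n]],
        hatom Corr [c, s, hcons (HP (HP (HN 3) (HP f y)) (HS n)) l]),
     ([], hatom Solv [s, HN 0]),
     ([hatom Sat [s, HN 0, x], hatom Solv [s, l]], hatom Solv [s, hcons x l]),
     ([hatom Corr [c, s, s], hatom Solv [s, c]], hatom Main [c, s])])"

definition clauses :: "hclause list" where
  "clauses = list_clauses @ ev_clauses @ num_clauses @ val_clauses @ sat_clauses @ occ_clauses @
     corr_clauses"

section \<open>The clauses as derivation rules\<close>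

abbreviation derives :: "nat \<Rightarrow> nat list \<Rightarrow> bool" where
  "derives q xs \<equiv> derivable clauses (atom_code q xs)"

text \<open>The assignment is given by a finite list, so that the simplifier can compute each
  instance of a clause.\<close>

lemma derives_clause:
  assumes "set cls \<subseteq> set clauses" "k < length cls"
    and "\<forall>p\<in>set (fst (cls ! k)). derivable clauses (hval ((!) xs) p)"
  shows "derivable clauses (hval ((!) xs) (snd (cls ! k)))"
proof (rule derivable.intros)
  show "(fst (cls ! k), snd (cls ! k)) \<in> set clauses"
    using assms(1,2) nth_mem by auto
qed (use assms(3) in blast)

lemma list_clauses_subset: "set list_clauses \<subseteq> set clauses"
  by (auto simp: clauses_def)

lemma derives_list_clauses:
  shows "derives Nth [Suc (prod_encode (x, l)), 0, x]"
  and "derives Nth [l, i, x] \<Longrightarrow> derives Nth [Suc (prod_encode (y, l)), Suc i, x]"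
  and "derives Neq [0, Suc n]"
  and "derives Neq [Suc m, 0]"
  and "derives Neq [m, n] \<Longrightarrow> derives Neq [Suc m, Suc n]"
  and "derives Fresh [x, 0]"
  and "derives Neq [x, y] \<Longrightarrow> derives Fresh [x, l] \<Longrightarrow>
      derives Fresh [x, Suc (prod_encode (prod_encode (y, n), l))]"
  and "derives Len [0, 0]"
  and "derives Len [l, k] \<Longrightarrow> derives Len [Suc (prod_encode (x, l)), Suc (prod_encode (y, k))]"
  subgoal using derives_clause[OF list_clauses_subset, of 0 "[i, k, l, m, n, x, y]"]
    by (simp add: list_clauses_def Let_def)
  subgoal using derives_clause[OF list_clauses_subset, of 1 "[i, k, l, m, n, x, y]"]
    by (simp add: list_clauses_def Let_def)
  subgoal using derives_clause[OF list_clauses_subset, of 2 "[i, k, l, m, n, x, y]"]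
    by (simp add: list_clauses_def Let_def)
  subgoal using derives_clause[OF list_clauses_subset, of 3 "[i, k, l, m, n, x, y]"]
    by (simp add: list_clauses_def Let_def)
  subgoal using derives_clause[OF list_clauses_subset, of 4 "[i, k, l, m, n, x, y]"]
    by (simp add: list_clauses_def Let_def)
  subgoal using derives_clause[OF list_clauses_subset, of 5 "[i, k, l, m, n, x, y]"]
    by (simp add: list_clauses_def Let_def)
  subgoal using derives_clause[OF list_clauses_subset, of 6 "[i, k, l, m, n, x, y]"]
    by (simp add: list_clauses_def Let_def)
  subgoal using derives_clause[OF list_clauses_subset, of 7 "[i, k, l, m, n, x, y]"]
    by (simp add: list_clauses_def Let_def)
  subgoal using derives_clause[OF list_clauses_subset, of 8 "[i, k, l, m, n, x, y]"]
    by (simp add: list_clauses_def Let_def)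
  done

lemma ev_clauses_subset: "set ev_clauses \<subseteq> set clauses"
  by (auto simp: clauses_def)

lemma derives_ev_clauses:
  shows "derives Ev [prod_encode (0, 0), l, 0]"
  and "derives Ev [prod_encode (1, 0), Suc (prod_encode (x, 0)), Suc x]"
  and "derives Nth [l, i, x] \<Longrightarrow> derives Ev [prod_encode (2, i), l, x]"
  and "derives Evs [g, l, k] \<Longrightarrow> derives Ev [f, k, x] \<Longrightarrow>
      derives Ev [prod_encode (3, prod_encode (f, g)), l, x]"
  and "derives Ev [f, l, x] \<Longrightarrow>
      derives Ev [prod_encode (4, prod_encode (f, g)), Suc (prod_encode (0, l)), x]"
  and "derives Ev [prod_encode (4, prod_encode (f, g)), Suc (prod_encode (n, l)), y] \<Longrightarrow>
      derives Ev [g, Suc (prod_encode (n, Suc (prod_encode (y, l)))), x] \<Longrightarrow>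
      derives Ev [prod_encode (4, prod_encode (f, g)), Suc (prod_encode (Suc n, l)), x]"
  and "derives Evs [0, l, 0]"
  and "derives Ev [f, l, x] \<Longrightarrow> derives Evs [g, l, k] \<Longrightarrow>
      derives Evs [Suc (prod_encode (f, g)), l, Suc (prod_encode (x, k))]"
  subgoal using derives_clause[OF ev_clauses_subset, of 0 "[f, g, i, k, l, n, x, y]"]
    by (simp add: ev_clauses_def Let_def)
  subgoal using derives_clause[OF ev_clauses_subset, of 1 "[f, g, i, k, l, n, x, y]"]
    by (simp add: ev_clauses_def Let_def)
  subgoal using derives_clause[OF ev_clauses_subset, of 2 "[f, g, i, k, l, n, x, y]"]
    by (simp add: ev_clauses_def Let_def)
  subgoal using derives_clause[OF ev_clauses_subset, of 3 "[f, g, i, k, l, n, x, y]"]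
    by (simp add: ev_clauses_def Let_def)
  subgoal using derives_clause[OF ev_clauses_subset, of 4 "[f, g, i, k, l, n, x, y]"]
    by (simp add: ev_clauses_def Let_def)
  subgoal using derives_clause[OF ev_clauses_subset, of 5 "[f, g, i, k, l, n, x, y]"]
    by (simp add: ev_clauses_def Let_def)
  subgoal using derives_clause[OF ev_clauses_subset, of 6 "[f, g, i, k, l, n, x, y]"]
    by (simp add: ev_clauses_def Let_def)
  subgoal using derives_clause[OF ev_clauses_subset, of 7 "[f, g, i, k, l, n, x, y]"]
    by (simp add: ev_clauses_def Let_def)
  done

lemma num_clauses_subset: "set num_clauses \<subseteq> set clauses"
  by (auto simp: clauses_def)

lemma derives_num_clauses:
  shows "derives Numl [0, prod_encode (1, 0)]"
  and "derives Numl [n, x] \<Longrightarrow> derives Numl [Suc n, prod_encode (2, x)]"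
  and "derives Nums [0, 0]"
  and "derives Numl [n, x] \<Longrightarrow> derives Nums [l, k] \<Longrightarrow>
      derives Nums [Suc (prod_encode (n, l)), Suc (prod_encode (x, k))]"
  subgoal using derives_clause[OF num_clauses_subset, of 0 "[k, l, n, x]"]
    by (simp add: num_clauses_def Let_def)
  subgoal using derives_clause[OF num_clauses_subset, of 1 "[k, l, n, x]"]
    by (simp add: num_clauses_def Let_def)
  subgoal using derives_clause[OF num_clauses_subset, of 2 "[k, l, n, x]"]
    by (simp add: num_clauses_def Let_def)
  subgoal using derives_clause[OF num_clauses_subset, of 3 "[k, l, n, x]"]
    by (simp add: num_clauses_def Let_def)
  done

lemma val_clauses_subset: "set val_clauses \<subseteq> set clauses"
  by (auto simp: clauses_def)

lemma derives_val_clauses: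
  shows "derives Nth [l, i, n] \<Longrightarrow> derives Val [s, l, prod_encode (0, i), n]"
  and "derives Val [s, l, prod_encode (1, 0), 0]"
  and "derives Val [s, l, x, n] \<Longrightarrow> derives Val [s, l, prod_encode (2, x), Suc n]"
  and "derives Vals [s, l, g, k] \<Longrightarrow> derives Nums [k, y] \<Longrightarrow>
      derives Nth [s, i, prod_encode (prod_encode (3, prod_encode (f, y)), 0)] \<Longrightarrow>
      derives Val [s, l, prod_encode (3, prod_encode (f, g)), 0]"
  and "derives Vals [s, l, g, k] \<Longrightarrow> derives Nums [k, y] \<Longrightarrow>
      derives Nth [s, i, prod_encode (prod_encode (3, prod_encode (f, y)), Suc n)] \<Longrightarrow>
      derives Val [s, l, prod_encode (3, prod_encode (f, g)), n]"
  and "derives Vals [s, l, 0, 0]"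
  and "derives Val [s, l, x, n] \<Longrightarrow> derives Vals [s, l, g, k] \<Longrightarrow>
      derives Vals [s, l, Suc (prod_encode (x, g)), Suc (prod_encode (n, k))]"
  subgoal using derives_clause[OF val_clauses_subset, of 0 "[f, g, i, k, l, n, s, x, y]"]
    by (simp add: val_clauses_def Let_def)
  subgoal using derives_clause[OF val_clauses_subset, of 1 "[f, g, i, k, l, n, s, x, y]"]
    by (simp add: val_clauses_def Let_def)
  subgoal using derives_clause[OF val_clauses_subset, of 2 "[f, g, i, k, l, n, s, x, y]"]
    by (simp add: val_clauses_def Let_def)
  subgoal using derives_clause[OF val_clauses_subset, of 3 "[f, g, i, k, l, n, s, x, y]"]
    by (simp add: val_clauses_def Let_def)
  subgoal using derives_clause[OF val_clauses_subset, of 4 "[f, g, i, k, l, n, s, x, y]"]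
    by (simp add: val_clauses_def Let_def)
  subgoal using derives_clause[OF val_clauses_subset, of 5 "[f, g, i, k, l, n, s, x, y]"]
    by (simp add: val_clauses_def Let_def)
  subgoal using derives_clause[OF val_clauses_subset, of 6 "[f, g, i, k, l, n, s, x, y]"]
    by (simp add: val_clauses_def Let_def)
  done

lemma sat_clauses_subset: "set sat_clauses \<subseteq> set clauses"
  by (auto simp: clauses_def)

lemma derives_sat_clauses:
  shows "derives Vals [s, l, g, k] \<Longrightarrow> derives Ev [f, k, 0] \<Longrightarrow>
      derives Sat [s, l, prod_encode (0, prod_encode (f, g))]"
  and "derives Unsat [s, l, x] \<Longrightarrow> derives Sat [s, l, prod_encode (1, x)]"
  and "derives Sat [s, l, x] \<Longrightarrow> derives Sat [s, l, y] \<Longrightarrow>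
      derives Sat [s, l, prod_encode (2, prod_encode (x, y))]"
  and "derives Sat [s, l, x] \<Longrightarrow> derives Sat [s, l, prod_encode (3, prod_encode (x, y))]"
  and "derives Sat [s, l, y] \<Longrightarrow> derives Sat [s, l, prod_encode (3, prod_encode (x, y))]"
  and "derives Vals [s, l, g, k] \<Longrightarrow> derives Ev [f, k, Suc n] \<Longrightarrow>
      derives Unsat [s, l, prod_encode (0, prod_encode (f, g))]"
  and "derives Sat [s, l, x] \<Longrightarrow> derives Unsat [s, l, prod_encode (1, x)]"
  and "derives Unsat [s, l, x] \<Longrightarrow> derives Unsat [s, l, prod_encode (2, prod_encode (x, y))]"
  and "derives Unsat [s, l, y] \<Longrightarrow> derives Unsat [s, l, prod_encode (2, prod_encode (x, y))]"
  and "derives Unsat [s, l, x] \<Longrightarrow> derives Unsat [s, l, y] \<Longrightarrow>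
      derives Unsat [s, l, prod_encode (3, prod_encode (x, y))]"
  and "derives Below [s, l, x, 0]"
  and "derives Below [s, l, x, n] \<Longrightarrow> derives Unsat [s, Suc (prod_encode (n, l)), x] \<Longrightarrow>
      derives Below [s, l, x, Suc n]"
  subgoal using derives_clause[OF sat_clauses_subset, of 0 "[f, g, k, l, n, s, x, y]"]
    by (simp add: sat_clauses_def Let_def)
  subgoal using derives_clause[OF sat_clauses_subset, of 1 "[f, g, k, l, n, s, x, y]"]
    by (simp add: sat_clauses_def Let_def)
  subgoal using derives_clause[OF sat_clauses_subset, of 2 "[f, g, k, l, n, s, x, y]"]
    by (simp add: sat_clauses_def Let_def)
  subgoal using derives_clause[OF sat_clauses_subset, of 3 "[f, g, k, l, n, s, x, y]"]
    by (simp add: sat_clauses_def Let_def)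
  subgoal using derives_clause[OF sat_clauses_subset, of 4 "[f, g, k, l, n, s, x, y]"]
    by (simp add: sat_clauses_def Let_def)
  subgoal using derives_clause[OF sat_clauses_subset, of 5 "[f, g, k, l, n, s, x, y]"]
    by (simp add: sat_clauses_def Let_def)
  subgoal using derives_clause[OF sat_clauses_subset, of 6 "[f, g, k, l, n, s, x, y]"]
    by (simp add: sat_clauses_def Let_def)
  subgoal using derives_clause[OF sat_clauses_subset, of 7 "[f, g, k, l, n, s, x, y]"]
    by (simp add: sat_clauses_def Let_def)
  subgoal using derives_clause[OF sat_clauses_subset, of 8 "[f, g, k, l, n, s, x, y]"]
    by (simp add: sat_clauses_def Let_def)
  subgoal using derives_clause[OF sat_clauses_subset, of 9 "[f, g, k, l, n, s, x, y]"]
    by (simp add: sat_clauses_def Let_def)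
  subgoal using derives_clause[OF sat_clauses_subset, of 10 "[f, g, k, l, n, s, x, y]"]
    by (simp add: sat_clauses_def Let_def)
  subgoal using derives_clause[OF sat_clauses_subset, of 11 "[f, g, k, l, n, s, x, y]"]
    by (simp add: sat_clauses_def Let_def)
  done

lemma occ_clauses_subset: "set occ_clauses \<subseteq> set clauses"
  by (auto simp: clauses_def)

lemma derives_occ_clauses:
  shows "derives Nth [s, i, x] \<Longrightarrow> derives OccF [s, x]"
  and "derives OccF [s, prod_encode (1, x)] \<Longrightarrow> derives OccF [s, x]"
  and "derives OccF [s, prod_encode (2, prod_encode (x, y))] \<Longrightarrow> derives OccF [s, x]"
  and "derives OccF [s, prod_encode (2, prod_encode (x, y))] \<Longrightarrow> derives OccF [s, y]"
  and "derives OccF [s, prod_encode (3, prod_encode (x, y))] \<Longrightarrow> derives OccF [s, x]"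
  and "derives OccF [s, prod_encode (3, prod_encode (x, y))] \<Longrightarrow> derives OccF [s, y]"
  and "derives OccT [s, prod_encode (3, prod_encode (f, g))] \<Longrightarrow> derives OccF [s, f]"
  and "derives OccF [s, prod_encode (0, prod_encode (f, g))] \<Longrightarrow> derives Nth [g, i, x] \<Longrightarrow>
      derives OccT [s, x]"
  and "derives OccT [s, prod_encode (2, x)] \<Longrightarrow> derives OccT [s, x]"
  and "derives OccT [s, prod_encode (3, prod_encode (f, g))] \<Longrightarrow> derives Nth [g, i, x] \<Longrightarrow>
      derives OccT [s, x]"
  subgoal using derives_clause[OF occ_clauses_subset, of 0 "[f, g, i, s, x, y]"]
    by (simp add: occ_clauses_def Let_def)
  subgoal using derives_clause[OF occ_clauses_subset, of 1 "[f, g, i, s, x, y]"]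
    by (simp add: occ_clauses_def Let_def)
  subgoal using derives_clause[OF occ_clauses_subset, of 2 "[f, g, i, s, x, y]"]
    by (simp add: occ_clauses_def Let_def)
  subgoal using derives_clause[OF occ_clauses_subset, of 3 "[f, g, i, s, x, y]"]
    by (simp add: occ_clauses_def Let_def)
  subgoal using derives_clause[OF occ_clauses_subset, of 4 "[f, g, i, s, x, y]"]
    by (simp add: occ_clauses_def Let_def)
  subgoal using derives_clause[OF occ_clauses_subset, of 5 "[f, g, i, s, x, y]"]
    by (simp add: occ_clauses_def Let_def)
  subgoal using derives_clause[OF occ_clauses_subset, of 6 "[f, g, i, s, x, y]"]
    by (simp add: occ_clauses_def Let_def)
  subgoal using derives_clause[OF occ_clauses_subset, of 7 "[f, g, i, s, x, y]"]
    by (simp add: occ_clauses_def Let_def)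
  subgoal using derives_clause[OF occ_clauses_subset, of 8 "[f, g, i, s, x, y]"]
    by (simp add: occ_clauses_def Let_def)
  subgoal using derives_clause[OF occ_clauses_subset, of 9 "[f, g, i, s, x, y]"]
    by (simp add: occ_clauses_def Let_def)
  done

lemma corr_clauses_subset: "set corr_clauses \<subseteq> set clauses"
  by (auto simp: clauses_def)

lemma derives_corr_clauses:
  shows "derives Corr [c, s, 0]"
  and "derives Corr [c, s, l] \<Longrightarrow> derives Fresh [prod_encode (3, prod_encode (f, y)), l] \<Longrightarrow>
      derives OccT [c, prod_encode (3, prod_encode (f, g))] \<Longrightarrow> derives Len [g, k] \<Longrightarrow>
      derives Nums [k, y] \<Longrightarrow>
      derives Corr [c, s, Suc (prod_encode (prod_encode (prod_encode (3, prod_encode (f, y)), 0), l))]"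
  and "derives Corr [c, s, l] \<Longrightarrow> derives Fresh [prod_encode (3, prod_encode (f, y)), l] \<Longrightarrow>
      derives OccT [c, prod_encode (3, prod_encode (f, g))] \<Longrightarrow> derives Len [g, k] \<Longrightarrow>
      derives Nums [k, y] \<Longrightarrow> derives Sat [s, Suc (prod_encode (n, k)), f] \<Longrightarrow>
      derives Below [s, k, f, n] \<Longrightarrow>
      derives Corr [c, s, Suc (prod_encode (prod_encode (prod_encode (3, prod_encode (f, y)), Suc n), l))]"
  and "derives Solv [s, 0]"
  and "derives Sat [s, 0, x] \<Longrightarrow> derives Solv [s, l] \<Longrightarrow> derives Solv [s, Suc (prod_encode (x, l))]"
  and "derives Corr [c, s, s] \<Longrightarrow> derives Solv [s, c] \<Longrightarrow> derives Main [c, s]"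
  subgoal using derives_clause[OF corr_clauses_subset, of 0 "[c, f, g, k, l, n, s, x, y]"]
    by (simp add: corr_clauses_def Let_def)
  subgoal using derives_clause[OF corr_clauses_subset, of 1 "[c, f, g, k, l, n, s, x, y]"]
    by (simp add: corr_clauses_def Let_def)
  subgoal using derives_clause[OF corr_clauses_subset, of 2 "[c, f, g, k, l, n, s, x, y]"]
    by (simp add: corr_clauses_def Let_def)
  subgoal using derives_clause[OF corr_clauses_subset, of 3 "[c, f, g, k, l, n, s, x, y]"]
    by (simp add: corr_clauses_def Let_def)
  subgoal using derives_clause[OF corr_clauses_subset, of 4 "[c, f, g, k, l, n, s, x, y]"]
    by (simp add: corr_clauses_def Let_def)
  subgoal using derives_clause[OF corr_clauses_subset, of 5 "[c, f, g, k, l, n, s, x, y]"]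
    by (simp add: corr_clauses_def Let_def)
  done

section \<open>The standard model\<close>

text \<open>The default 0 for a Skolem term without witness agrees with the value that
  \<open>eval\<close> gives to \<open>?\<close>. The formula naming a Skolem function is evaluated
  only at the witness and the argument values, since its variables belong to the name.\<close>

primrec val :: "tm \<Rightarrow> nat list \<Rightarrow> nat" and holds :: "fm \<Rightarrow> nat list \<Rightarrow> bool" where
  "val (Var i) \<rho> = (if i < length \<rho> then \<rho> ! i else 0)"
| "val Zero \<rho> = 0"
| "val (Succ t) \<rho> = Suc (val t \<rho>)"
| "val (Sk \<phi> ts) \<rho> =
     (if \<exists>v. holds \<phi> (v # map (\<lambda>t. val t \<rho>) ts) then LEAST v. holds \<phi> (v # map (\<lambda>t. val t \<rho>) ts) else 0)"
| "holds (Atom R ts) \<rho> \<longleftrightarrow> rel_holds R (map (\<lambda>t. val t \<rho>) ts)"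
| "holds (Neg \<phi>) \<rho> \<longleftrightarrow> \<not> holds \<phi> \<rho>"
| "holds (And \<phi> \<psi>) \<rho> \<longleftrightarrow> holds \<phi> \<rho> \<and> holds \<psi> \<rho>"
| "holds (Or \<phi> \<psi>) \<rho> \<longleftrightarrow> holds \<phi> \<rho> \<or> holds \<psi> \<rho>"

lemma val_num [simp]: "val (num n) \<rho> = n"
  by (induction n) auto

text \<open>The defining property of the epsilon operator, by which the quantifier-free abbreviation
  expresses real existence.\<close>

lemma holds_val_Sk:
  "holds \<phi> (val (Sk \<phi> ts) \<rho> # map (\<lambda>t. val t \<rho>) ts) \<longleftrightarrow> (\<exists>v. holds \<phi> (v # map (\<lambda>t. val t \<rho>) ts))"
  using LeastI_ex[of "\<lambda>v. holds \<phi> (v # map (\<lambda>t. val t \<rho>) ts)"] by auto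

section \<open>Substitution and truth of the critical formulas\<close>

lemma val_subst_eq:
  "(\<And>i. i \<in> tm_vars t \<Longrightarrow> val (\<sigma> i) \<rho> = val (Var i) \<rho>') \<Longrightarrow> val (tm_subst \<sigma> t) \<rho> = val t \<rho>'"
  and holds_subst_eq:
  "(\<And>i. i \<in> fm_vars \<phi> \<Longrightarrow> val (\<sigma> i) \<rho> = val (Var i) \<rho>') \<Longrightarrow> holds (fm_subst \<sigma> \<phi>) \<rho> \<longleftrightarrow> holds \<phi> \<rho>'"
proof (induction t and \<phi>)
  case (Sk \<phi> ts)
  then have eq: "map (\<lambda>t. val (tm_subst \<sigma> t) \<rho>) ts = map (\<lambda>t. val t \<rho>') ts" by auto
  then show ?case by (simp add: comp_def eq del: map_eq_conv)
next
  case (Atom R ts)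
  then have eq: "map (\<lambda>t. val (tm_subst \<sigma> t) \<rho>) ts = map (\<lambda>t. val t \<rho>') ts" by auto
  then show ?case by (simp add: comp_def eq del: map_eq_conv)
qed auto

lemma val_subst_cong:
  "(\<And>i. val (\<sigma> i) \<rho> = val (\<tau> i) \<rho>) \<Longrightarrow> val (tm_subst \<sigma> t) \<rho> = val (tm_subst \<tau> t) \<rho>"
  and holds_subst_cong:
  "(\<And>i. val (\<sigma> i) \<rho> = val (\<tau> i) \<rho>) \<Longrightarrow> holds (fm_subst \<sigma> \<phi>) \<rho> \<longleftrightarrow> holds (fm_subst \<tau> \<phi>) \<rho>"
proof (induction t and \<phi>)
  case (Sk \<phi> ts)
  then have eq: "map (\<lambda>t. val (tm_subst \<sigma> t) \<rho>) ts = map (\<lambda>t. val (tm_subst \<tau> t) \<rho>) ts" by auto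
  then show ?case by (simp add: comp_def eq del: map_eq_conv)
next
  case (Atom R ts)
  then have eq: "map (\<lambda>t. val (tm_subst \<sigma> t) \<rho>) ts = map (\<lambda>t. val (tm_subst \<tau> t) \<rho>) ts" by auto
  then show ?case by (simp add: comp_def eq del: map_eq_conv)
qed auto

lemma holds_subst1: "holds (fm_subst1 x t \<phi>) \<rho> \<longleftrightarrow> holds (fm_subst1 x (num (val t \<rho>)) \<phi>) \<rho>"
  unfolding fm_subst1_def by (rule holds_subst_cong) simp

lemma tm_subst_subst: "tm_subst \<sigma> (tm_subst \<tau> t) = tm_subst (tm_subst \<sigma> \<circ> \<tau>) t"
  and fm_subst_subst: "fm_subst \<sigma> (fm_subst \<tau> \<phi>) = fm_subst (tm_subst \<sigma> \<circ> \<tau>) \<phi>"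
  by (induction t and \<phi>) auto

lemma tm_subst_cong: "(\<And>i. i \<in> tm_vars t \<Longrightarrow> \<sigma> i = \<tau> i) \<Longrightarrow> tm_subst \<sigma> t = tm_subst \<tau> t"
  and fm_subst_cong: "(\<And>i. i \<in> fm_vars \<phi> \<Longrightarrow> \<sigma> i = \<tau> i) \<Longrightarrow> fm_subst \<sigma> \<phi> = fm_subst \<tau> \<phi>"
  by (induction t and \<phi>) auto

lemma tm_subst_Var [simp]: "tm_subst Var t = t"
  and fm_subst_Var [simp]: "fm_subst Var \<phi> = \<phi>"
  by (induction t and \<phi>) (auto intro: map_idI)

lemma tm_subst_upd_fresh: "x \<notin> tm_vars t \<Longrightarrow> tm_subst (Var(x := s)) t = t"
  using tm_subst_cong[of t "Var(x := s)" Var] by (metis fun_upd_other tm_subst_Var)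

lemma tm_over_mono: "tm_over \<Sigma> t \<Longrightarrow> \<Sigma> \<subseteq> \<Sigma>' \<Longrightarrow> tm_over \<Sigma>' t"
  and fm_over_mono: "fm_over \<Sigma> \<phi> \<Longrightarrow> \<Sigma> \<subseteq> \<Sigma>' \<Longrightarrow> fm_over \<Sigma>' \<phi>"
  by (induction t and \<phi>) (auto simp: list_all_iff)

lemma Skolem_formula:
  assumes "(k, \<phi>) \<in> Skolem"
  shows "L_fm \<phi>" "fm_vars \<phi> \<subseteq> {0..k}"
proof -
  have "L_fm \<phi> \<and> fm_vars \<phi> \<subseteq> {0..k}" if "(k, \<phi>) \<in> skolem_funs n" for n
    using that
  proof (induction n)
    case (Suc n)
    have "skolem_funs n \<subseteq> Skolem" by (auto simp: Skolem_def)
    with Suc show ?case by (auto intro: fm_over_mono)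
  qed simp
  with assms show "L_fm \<phi>" "fm_vars \<phi> \<subseteq> {0..k}" by (auto simp: Skolem_def)
qed

lemma holds_inst:
  assumes "fm_vars \<phi> \<subseteq> {0..length ts}"
  shows "holds (inst \<phi> s ts) \<rho> \<longleftrightarrow> holds \<phi> (val s \<rho> # map (\<lambda>t. val t \<rho>) ts)"
  unfolding inst_def using assms
  by (intro holds_subst_eq) (auto simp: nth_Cons split: nat.split)

lemma subst1_inst:
  assumes "fm_vars \<phi> \<subseteq> {0..length ts}" "\<And>t. t \<in> set ts \<Longrightarrow> x \<notin> tm_vars t"
  shows "fm_subst1 x s (inst \<phi> (Var x) ts) = inst \<phi> s ts"
  unfolding inst_def fm_subst1_def fm_subst_subst using assms
  by (intro fm_subst_cong) (auto simp: nth_Cons tm_subst_upd_fresh split: nat.split)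

text \<open>Whichever decomposition into matrix and parameters was chosen, the Skolem term takes a
  witness as value if there is one, so the truth value does not depend on the choice.\<close>

lemma holds_ex_abbrev:
  assumes "ex_abbrev x \<psi> \<chi>"
  shows "holds \<chi> \<rho> \<longleftrightarrow> (\<exists>v. holds (fm_subst1 x (num v) \<psi>) \<rho>)"
proof -
  obtain \<phi> ts where \<phi>: "(length ts, \<phi>) \<in> Skolem" "\<And>t. t \<in> set ts \<Longrightarrow> x \<notin> tm_vars t"
    "\<psi> = inst \<phi> (Var x) ts" "\<chi> = inst \<phi> (Sk \<phi> ts) ts"
    using assms by (auto simp: ex_abbrev_def)
  note vars = Skolem_formula(2)[OF \<phi>(1)]
  have "fm_subst1 x s \<psi> = inst \<phi> s ts" for s
    unfolding \<phi>(3) using vars \<phi>(2) by (rule subst1_inst)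
  then show ?thesis
    using holds_val_Sk[of \<phi> ts \<rho>] by (simp add: \<phi>(4) holds_inst[OF vars])
qed

lemma critical_form_holds: "critical_form C \<Longrightarrow> holds C \<rho>"
proof (induction rule: critical_form.induct)
  case (1 x \<phi> \<chi> t)
  then show ?case using holds_subst1[of x t \<phi> \<rho>] by (auto simp: holds_ex_abbrev)
next
  case (2 x \<phi> \<chi> t)
  have subst: "fm_subst1 x (num v) (fm_subst1 x (Succ (Var x)) \<phi>) = fm_subst1 x (num (Suc v)) \<phi>" for v
    unfolding fm_subst1_def fm_subst_subst by (rule fm_subst_cong) auto
  \<comment> \<open>If truth never changed from one number to the next, it would propagate from 0 up
    to \<open>n\<close>.\<close>
  have "\<exists>v. holds (fm_subst1 x (num v) \<phi>) \<rho> \<and> \<not> holds (fm_subst1 x (num (Suc v)) \<phi>) \<rho>"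
    if "holds (fm_subst1 x (num 0) \<phi>) \<rho>" "\<not> holds (fm_subst1 x (num n) \<phi>) \<rho>" for n
    using that by (induction n) auto
  from this[of "val t \<rho>"] show ?case
    using 2 subst holds_subst1[of x t] by (auto simp: holds_ex_abbrev fm_subst1_def)
next
  case (3 x s \<chi>)
  have "holds (fm_subst1 x (num v) (Eq s (Succ (Var x)))) \<rho> \<longleftrightarrow> val s \<rho> = Suc v" for v
    using 3(1) by (simp add: fm_subst1_def tm_subst_upd_fresh rel_holds_eq_rec)
  then show ?case
    using 3(2) by (auto simp: holds_ex_abbrev rel_holds_eq_rec gr0_conv_Suc)
qed

section \<open>The finite set of canonical terms to be tabulated\<close>

text \<open>Not only the least witness but every number up to it: these are the instances that
  correctness of the value inspects. Without a witness the set is empty, matching the fact that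
  \<open>?\<close> requires no inspection.\<close>

definition witnesses :: "fm \<Rightarrow> nat list \<Rightarrow> nat set" where
  "witnesses \<phi> ns = {u. \<exists>v. holds \<phi> (v # ns) \<and> u \<le> (LEAST v. holds \<phi> (v # ns))}"

text \<open>The canonical terms whose values are consulted when a term or formula is evaluated and when
  the values consulted are in turn checked for correctness.\<close>

primrec tm_support :: "tm \<Rightarrow> nat list \<Rightarrow> tm set" and fm_support :: "fm \<Rightarrow> nat list \<Rightarrow> tm set" where
  "tm_support (Var i) \<rho> = {}"
| "tm_support Zero \<rho> = {}"
| "tm_support (Succ t) \<rho> = tm_support t \<rho>"
| "tm_support (Sk \<phi> ts) \<rho> =
     insert (Sk \<phi> (map (\<lambda>t. num (val t \<rho>)) ts))
       (\<Union> (set (map (\<lambda>t. tm_support t \<rho>) ts)) \<union>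
        (\<Union>u\<in>witnesses \<phi> (map (\<lambda>t. val t \<rho>) ts). fm_support \<phi> (u # map (\<lambda>t. val t \<rho>) ts)))"
| "fm_support (Atom R ts) \<rho> = \<Union> (set (map (\<lambda>t. tm_support t \<rho>) ts))"
| "fm_support (Neg \<phi>) \<rho> = fm_support \<phi> \<rho>"
| "fm_support (And \<phi> \<psi>) \<rho> = fm_support \<phi> \<rho> \<union> fm_support \<psi> \<rho>"
| "fm_support (Or \<phi> \<psi>) \<rho> = fm_support \<phi> \<rho> \<union> fm_support \<psi> \<rho>"

lemma finite_witnesses: "finite (witnesses \<phi> ns)"
  by (rule finite_subset[of _ "{..LEAST v. holds \<phi> (v # ns)}"]) (auto simp: witnesses_def)

lemma finite_tm_support: "finite (tm_support t \<rho>)"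
  and finite_fm_support: "finite (fm_support \<phi> \<rho>)"
  by (induction t and \<phi> arbitrary: \<rho> and \<rho>) (auto simp: finite_witnesses)

section \<open>Completeness of the clauses\<close>

lemma derives_nth: "i < length xs \<Longrightarrow> derives Nth [list_encode xs, i, xs ! i]"
proof (induction xs arbitrary: i)
  case (Cons x xs)
  then show ?case by (cases i) (auto intro: derives_list_clauses)
qed simp

lemma derives_mem: "x \<in> set xs \<Longrightarrow> \<exists>i. derives Nth [list_encode xs, i, x]"
  using derives_nth by (fastforce simp: in_set_conv_nth)

lemma derives_neq: "m \<noteq> n \<Longrightarrow> derives Neq [m, n]"
proof (induction m arbitrary: n)
  case 0
  then show ?case by (cases n) (auto intro: derives_list_clauses)
next
  case (Suc m)
  then show ?case by (cases n) (auto intro: derives_list_clauses)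
qed

lemma derives_len: "length xs = length ys \<Longrightarrow> derives Len [list_encode xs, list_encode ys]"
  by (induction xs ys rule: list_induct2) (auto intro: derives_list_clauses)

inductive_cases is_primrec_elims:
  "is_primrec n (RComp f gs)"
  "is_primrec n (RPrec f g)"
  "is_primrec n (RMin f)"

text \<open>Primitive recursiveness passes to the functions used in a definition, so the induction
  never meets a minimization.\<close>

lemma derives_ev:
  "rec_eval f xs y \<Longrightarrow> is_primrec (length xs) f \<Longrightarrow> derives Ev [recf_code f, list_encode xs, y]"
proof (induction rule: rec_eval.induct)
  case (3 i xs)
  then show ?case using derives_nth by (auto intro: derives_ev_clauses)
next
  case (4 xs gs ys f z)
  then have prim: "is_primrec (length gs) f" "\<forall>g\<in>set gs. is_primrec (length xs) g"
    by (auto elim: is_primrec_elims)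
  have "derives Evs [list_encode (map recf_code gs), list_encode xs, list_encode ys]"
    using 4(1) prim(2) by (induction rule: list_all2_induct) (auto intro: derives_ev_clauses)
  moreover have "length gs = length ys" using 4(1) by (auto dest: list_all2_lengthD)
  ultimately show ?case using "4.IH"(2) prim(1) by (auto intro: derives_ev_clauses)
next
  case (5 f xs y g)
  then show ?case by (auto intro: derives_ev_clauses elim: is_primrec_elims)
next
  case (6 f g n xs r y)
  then have "is_primrec (Suc (Suc (length xs))) g" by (auto elim: is_primrec_elims)
  with 6 show ?case by (auto intro: derives_ev_clauses(6)[of _ _ _ _ r])
qed (auto intro: derives_ev_clauses[simplified] elim: is_primrec_elims)

lemma derives_nums: "derives Nums [list_encode ns, list_encode (map tm_code (map num ns))]"
proof (induction ns)
  case (Cons n ns)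
  have "derives Numl [n, tm_code (num n)]"
    by (induction n) (auto intro: derives_num_clauses[simplified])
  with Cons show ?case by (auto intro: derives_num_clauses)
qed (auto intro: derives_num_clauses)

definition table_code :: "(tm \<times> evalue) list \<Rightarrow> nat" where
  "table_code ps = list_encode (map (\<lambda>(e, v). prod_encode (tm_code e, evalue_code v)) ps)"

text \<open>Separates a least witness 0 from the absence of a witness, two cases that
  \<open>val\<close> identifies.\<close>

definition sk_value :: "fm \<Rightarrow> nat list \<Rightarrow> evalue" where
  "sk_value \<phi> ns = (if \<exists>v. holds \<phi> (v # ns) then Num (LEAST v. holds \<phi> (v # ns)) else Unknown)"

lemma derives_vals:
  assumes "\<And>t. t \<in> set ts \<Longrightarrow> derives Val [s, l, tm_code t, h t]"
  shows "derives Vals [s, l, list_encode (map tm_code ts), list_encode (map h ts)]"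
  using assms by (induction ts) (auto intro: derives_val_clauses)

text \<open>A Skolem term is looked up rather than evaluated through the formula in its name, so the
  induction runs over terms alone. All keys looked up lie in the support, hence in the tabulated set
  \<open>D\<close>.\<close>

lemma derives_val:
  assumes table: "\<And>\<phi> ns. Sk \<phi> (map num ns) \<in> D \<Longrightarrow> (Sk \<phi> (map num ns), sk_value \<phi> ns) \<in> set ps"
  shows "tm_vars t \<subseteq> {..<length \<rho>} \<Longrightarrow> tm_support t \<rho> \<subseteq> D \<Longrightarrow>
    derives Val [table_code ps, list_encode \<rho>, tm_code t, val t \<rho>]"
proof (induction t rule: tm.induct[where ?P2.0 = "\<lambda>_. True"])
  case (Var i)
  then show ?case using derives_nth[of i \<rho>] by (auto intro: derives_val_clauses)
next
  case Zero
  show ?case using derives_val_clauses(2) by simp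
next
  case (Succ t)
  then show ?case by (auto intro: derives_val_clauses)
next
  case (Sk \<phi> ts)
  let ?ns = "map (\<lambda>t. val t \<rho>) ts"
  have vals: "derives Vals [table_code ps, list_encode \<rho>, list_encode (map tm_code ts), list_encode ?ns]"
    using Sk by (intro derives_vals) (simp add: UN_subset_iff)
  have "(Sk \<phi> (map num ?ns), sk_value \<phi> ?ns) \<in> set ps"
    using Sk.prems(2) by (intro table) (auto simp: comp_def)
  then have "prod_encode (tm_code (Sk \<phi> (map num ?ns)), evalue_code (sk_value \<phi> ?ns)) \<in>
      set (map (\<lambda>(e, v). prod_encode (tm_code e, evalue_code v)) ps)"
    by force
  from derives_mem[OF this] obtain i where
    "derives Nth [table_code ps, i, prod_encode (tm_code (Sk \<phi> (map num ?ns)), evalue_code (sk_value \<phi> ?ns))]"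
    by (auto simp: table_code_def)
  with vals derives_nums[of ?ns] show ?case
    by (auto simp: sk_value_def intro: derives_val_clauses split: if_splits)
qed simp_all

text \<open>Both truth values are treated at once because negation exchanges them. For atoms,
  totality of primitive recursive functions provides the value that decides between the two.\<close>

lemma derives_sat:
  assumes table: "\<And>\<phi> ns. Sk \<phi> (map num ns) \<in> D \<Longrightarrow> (Sk \<phi> (map num ns), sk_value \<phi> ns) \<in> set ps"
  shows "L_fm \<phi> \<Longrightarrow> fm_vars \<phi> \<subseteq> {..<length \<rho>} \<Longrightarrow> fm_support \<phi> \<rho> \<subseteq> D \<Longrightarrow>
    derives (if holds \<phi> \<rho> then Sat else Unsat) [table_code ps, list_encode \<rho>, fm_code \<phi>]"
proof (induction \<phi> rule: fm.induct[where ?P1.0 = "\<lambda>_. True"])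
  case (Atom R ts)
  let ?ns = "map (\<lambda>t. val t \<rho>) ts"
  have vals: "derives Vals [table_code ps, list_encode \<rho>, list_encode (map tm_code ts), list_encode ?ns]"
    using Atom.prems
    by (intro derives_vals derives_val[where D = D] table) (simp_all add: UN_subset_iff)
  have prim: "is_primrec (length ?ns) R" using Atom by simp
  then obtain y where y: "rec_eval R ?ns y" using is_primrec_total by blast
  then have "derives Ev [recf_code R, list_encode ?ns, y]" using prim by (rule derives_ev)
  moreover have "rel_holds R ?ns \<longleftrightarrow> y = 0"
    using y by (auto simp: rel_holds_def dest: rec_eval_functional[OF y])
  ultimately show ?case using vals
    by (cases y) (auto intro: derives_sat_clauses)
qed (auto intro: derives_sat_clauses[simplified])

lemma derives_below:
  assumes "\<And>u. u < v \<Longrightarrow> derives Unsat [s, list_encode (u # ns), x]"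
  shows "derives Below [s, list_encode ns, x, v]"
  using assms by (induction v) (auto intro: derives_sat_clauses)

lemma derives_fresh:
  "e \<notin> fst ` set ps \<Longrightarrow> derives Fresh [tm_code e, table_code ps]"
proof (induction ps)
  case (Cons p ps)
  then have "derives Neq [tm_code e, tm_code (fst p)]" by (auto intro: derives_neq dest: tm_code_eq)
  with Cons show ?case by (cases p) (auto simp: table_code_def intro: derives_list_clauses)
qed (auto simp: table_code_def intro: derives_list_clauses)

text \<open>Two facts need the same descent into the names of Skolem functions. A consulted term
  shares its head and arity with an occurring term, although its arguments are values instead of the
  original terms; and the support is closed under the instances needed to certify the entry.\<close>

lemma support_occurs:
  "derives OccT [c, tm_code t] \<Longrightarrow> L_tm t \<Longrightarrow> e \<in> tm_support t \<rho> \<Longrightarrow>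
     \<exists>\<phi> ts ns. e = Sk \<phi> (map num ns) \<and> length ts = length ns \<and> (length ns, \<phi>) \<in> Skolem \<and>
       derives OccT [c, tm_code (Sk \<phi> ts)] \<and>
       (\<forall>u\<in>witnesses \<phi> ns. fm_support \<phi> (u # ns) \<subseteq> tm_support t \<rho>)"
  "derives OccF [c, fm_code \<psi>] \<Longrightarrow> L_fm \<psi> \<Longrightarrow> e \<in> fm_support \<psi> \<rho> \<Longrightarrow>
     \<exists>\<phi> ts ns. e = Sk \<phi> (map num ns) \<and> length ts = length ns \<and> (length ns, \<phi>) \<in> Skolem \<and>
       derives OccT [c, tm_code (Sk \<phi> ts)] \<and>
       (\<forall>u\<in>witnesses \<phi> ns. fm_support \<phi> (u # ns) \<subseteq> fm_support \<psi> \<rho>)"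
proof (induction t and \<psi> arbitrary: \<rho> and \<rho>)
  case (Succ t)
  then have "derives OccT [c, tm_code t]" by (auto intro: derives_occ_clauses(9))
  with Succ show ?case by simp
next
  case (Sk \<phi> ts)
  let ?ns = "map (\<lambda>t. val t \<rho>) ts"
  have \<phi>: "(length ts, \<phi>) \<in> Skolem" "L_fm \<phi>" using Sk.prems Skolem_formula by auto
  have occ_ts: "derives OccT [c, tm_code t]" if "t \<in> set ts" for t
    using that Sk.prems(1) derives_mem[of "tm_code t" "map tm_code ts"]
    by (auto intro: derives_occ_clauses(10))
  have occ_\<phi>: "derives OccF [c, fm_code \<phi>]"
    using Sk.prems(1) by (auto intro: derives_occ_clauses(7))
  consider "e = Sk \<phi> (map num ?ns)" | t where "t \<in> set ts" "e \<in> tm_support t \<rho>"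
    | u where "u \<in> witnesses \<phi> ?ns" "e \<in> fm_support \<phi> (u # ?ns)"
    using Sk.prems(3) by (auto simp: comp_def)
  then show ?case
  proof cases
    case 1
    then show ?thesis using \<phi> Sk.prems(1) by (intro exI[of _ \<phi>] exI[of _ ts] exI[of _ ?ns]) auto
  next
    case (2 t)
    then have "L_tm t" using Sk.prems(2) by (auto simp: list_all_iff)
    from Sk.IH(2)[OF 2(1) occ_ts[OF 2(1)] this 2(2)] 2(1) show ?thesis by fastforce
  next
    case (3 u)
    from Sk.IH(1)[OF occ_\<phi> \<phi>(2) 3(2)] 3(1) show ?thesis by fastforce
  qed
next
  case (Atom R ts)
  then obtain t where t: "t \<in> set ts" "e \<in> tm_support t \<rho>" by auto
  then have "derives OccT [c, tm_code t]"
    using Atom.prems(1) derives_mem[of "tm_code t" "map tm_code ts"]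
    by (auto intro: derives_occ_clauses(8))
  moreover have "L_tm t" using t Atom.prems(2) by (auto simp: list_all_iff)
  ultimately show ?case using Atom.IH[OF t(1) _ _ t(2)] t(1) by fastforce
next
  case (Neg \<phi>)
  then have "derives OccF [c, fm_code \<phi>]" by (auto intro: derives_occ_clauses(2))
  with Neg show ?case by simp
next
  case (And \<phi> \<phi>')
  then have "derives OccF [c, fm_code \<phi>]" "derives OccF [c, fm_code \<phi>']"
    by (auto intro: derives_occ_clauses(3,4))
  with And show ?case by (fastforce)
next
  case (Or \<phi> \<phi>')
  then have "derives OccF [c, fm_code \<phi>]" "derives OccF [c, fm_code \<phi>']"
    by (auto intro: derives_occ_clauses(5,6))
  with Or show ?case by (fastforce)
qed auto

lemma derives_main:
  assumes Cr: "\<forall>C\<in>set Cr. critical C \<and> fm_vars C = {}"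
  shows "\<exists>m. derives Main [fms_code Cr, m]"
proof -
  let ?c = "fms_code Cr"
  define D where "D = (\<Union>C\<in>set Cr. fm_support C [])"
  define entry where "entry e = (case e of Sk \<phi> ts \<Rightarrow> (e, sk_value \<phi> (map (\<lambda>t. val t []) ts)))" for e
  have entry: "entry (Sk \<phi> (map num ns)) = (Sk \<phi> (map num ns), sk_value \<phi> ns)" for \<phi> ns
    by (simp add: entry_def comp_def)
  have "finite D" unfolding D_def by (simp add: finite_fm_support)
  then obtain es where es: "set es = D" "distinct es" using finite_distinct_list by blast
  define ps where "ps = map entry es"
  have table: "(Sk \<phi> (map num ns), sk_value \<phi> ns) \<in> set ps" if "Sk \<phi> (map num ns) \<in> D" for \<phi> ns
  proof -
    have "entry (Sk \<phi> (map num ns)) \<in> set ps" using that es by (simp add: ps_def)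
    then show ?thesis by (simp add: entry)
  qed
  have sat: "derives Sat [table_code ps, 0, fm_code C]" if "C \<in> set Cr" for C
    using derives_sat[where \<rho> = "[]" and \<phi> = C, OF table] that Cr
      critical_form_holds[of C "[]"] by (auto simp: critical_def D_def)
  have D: "\<exists>\<phi> ts ns. e = Sk \<phi> (map num ns) \<and> length ts = length ns \<and> (length ns, \<phi>) \<in> Skolem \<and>
      derives OccT [?c, tm_code (Sk \<phi> ts)] \<and> (\<forall>u\<in>witnesses \<phi> ns. fm_support \<phi> (u # ns) \<subseteq> D)"
    if e: "e \<in> D" for e
  proof -
    obtain C where C: "C \<in> set Cr" "e \<in> fm_support C []" using e by (auto simp: D_def)
    then have "derives OccF [?c, fm_code C]"
      using derives_mem[of "fm_code C" "map fm_code Cr"] derives_occ_clauses(1)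
      by (auto simp: fms_code_def)
    moreover have "L_fm C" using C Cr by (auto simp: critical_def)
    moreover have "fm_support C [] \<subseteq> D" using C by (auto simp: D_def)
    ultimately show ?thesis
      using support_occurs(2)[where c = ?c and \<psi> = C and e = e and \<rho> = "[]"] C(2) by blast
  qed
  \<comment> \<open>Only the examined part grows in the induction. The full table stays fixed, since
    certifying one entry may consult any other.\<close>
  have corr: "derives Corr [?c, table_code ps, table_code (map entry es')]"
    if "set es' \<subseteq> D" "distinct es'" for es'
    using that
  proof (induction es')
    case Nil
    show ?case by (auto simp: table_code_def intro: derives_corr_clauses)
  next
    case (Cons e es')
    then obtain \<phi> ts ns where e: "e = Sk \<phi> (map num ns)" "length ts = length ns"
      "(length ns, \<phi>) \<in> Skolem" "derives OccT [?c, tm_code (Sk \<phi> ts)]"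
      "\<forall>u\<in>witnesses \<phi> ns. fm_support \<phi> (u # ns) \<subseteq> D"
      using D[of e] by auto
    have IH: "derives Corr [?c, table_code ps, table_code (map entry es')]"
      using Cons by simp
    have "fst ` set (map entry es') \<subseteq> set es'"
    proof -
      have "fst (entry e) = e" if "e \<in> D" for e
        using D[OF that] by (auto simp: entry)
      then show ?thesis using Cons.prems by auto
    qed
    then have fresh: "derives Fresh [tm_code e, table_code (map entry es')]"
      using Cons.prems by (intro derives_fresh) auto
    have len: "derives Len [list_encode (map tm_code ts), list_encode ns]"
      using e(2) by (intro derives_len) simp
    \<comment> \<open>Closure of \<open>D\<close> puts every term consulted by these instances into
      the table.\<close>
    have wit: "derives (if holds \<phi> (u # ns) then Sat else Unsat)
        [table_code ps, list_encode (u # ns), fm_code \<phi>]" if "u \<in> witnesses \<phi> ns" for u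
      using Skolem_formula[OF e(3)] e(5) that
      by (intro derives_sat[where D = D] table) auto
    show ?case
    proof (cases "\<exists>v. holds \<phi> (v # ns)")
      case False
      then show ?thesis
        using IH fresh e(4) len derives_nums[of ns] derives_corr_clauses(2)[where c = ?c]
        by (simp add: e(1) entry table_code_def sk_value_def)
    next
      case True
      define v where "v = (LEAST v. holds \<phi> (v # ns))"
      have v: "holds \<phi> (v # ns)" using True unfolding v_def by (rule LeastI_ex)
      have less: "\<not> holds \<phi> (u # ns)" if "u < v" for u
        using that not_less_Least unfolding v_def by blast
      have w: "u \<in> witnesses \<phi> ns" if "u \<le> v" for u
        using that True by (simp add: witnesses_def v_def)
      have "derives Sat [table_code ps, list_encode (v # ns), fm_code \<phi>]"
        using wit[OF w, of v] v by simp
      moreover have "derives Below [table_code ps, list_encode ns, fm_code \<phi>, v]"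
      proof (rule derives_below)
        fix u assume "u < v"
        then show "derives Unsat [table_code ps, list_encode (u # ns), fm_code \<phi>]"
          using wit[OF w, of u] less[of u] by simp
      qed
      moreover have "sk_value \<phi> ns = Num v" using True by (simp add: sk_value_def v_def)
      ultimately show ?thesis
        using IH fresh e(4) len derives_nums[of ns] derives_corr_clauses(3)[where c = ?c]
        by (simp add: e(1) entry table_code_def)
    qed
  qed
  have "derives Solv [table_code ps, list_encode (map fm_code Cr')]" if "set Cr' \<subseteq> set Cr" for Cr'
    using that by (induction Cr') (auto intro: derives_corr_clauses sat)
  then have "derives Solv [table_code ps, ?c]" by (simp add: fms_code_def)
  moreover have "derives Corr [?c, table_code ps, table_code ps]"
    using corr[of es] es by (simp add: ps_def)
  ultimately show ?thesis by (blast intro: derives_corr_clauses)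
qed

section \<open>Soundness of the clauses\<close>

lemma inj_codes [simp]: "inj recf_code" "inj tm_code" "inj fm_code"
  by (auto intro: injI recf_code_eq tm_code_eq fm_code_eq)

lemma code_eq_iff [simp]:
  "recf_code F = recf_code G \<longleftrightarrow> F = G" "tm_code s = tm_code t \<longleftrightarrow> s = t"
  "fm_code \<phi> = fm_code \<psi> \<longleftrightarrow> \<phi> = \<psi>"
  by (simp_all add: inj_eq)

text \<open>With the pattern of a clause on the left, these equivalences recover the syntax behind a
  number that matches it; the soundness proofs invert the clauses this way.\<close>

lemma recf_code_iff [simp]:
  "prod_encode (0, 0) = recf_code F \<longleftrightarrow> F = RZero"
  "prod_encode (Suc 0, 0) = recf_code F \<longleftrightarrow> F = RSucc"
  "prod_encode (2, i) = recf_code F \<longleftrightarrow> F = RProj i"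
  "prod_encode (3, prod_encode (f, g)) = recf_code F \<longleftrightarrow>
     (\<exists>F' G. F = RComp F' G \<and> f = recf_code F' \<and> g = list_encode (map recf_code G))"
  "prod_encode (4, prod_encode (f, g)) = recf_code F \<longleftrightarrow>
     (\<exists>F' G. F = RPrec F' G \<and> f = recf_code F' \<and> g = recf_code G)"
  by (cases F; auto)+

lemma tm_code_iff [simp]:
  "prod_encode (0, i) = tm_code t \<longleftrightarrow> t = Var i"
  "prod_encode (Suc 0, 0) = tm_code t \<longleftrightarrow> t = Zero"
  "prod_encode (2, x) = tm_code t \<longleftrightarrow> (\<exists>t'. t = Succ t' \<and> x = tm_code t')"
  "prod_encode (3, prod_encode (f, g)) = tm_code t \<longleftrightarrow>
     (\<exists>\<phi> ts. t = Sk \<phi> ts \<and> f = fm_code \<phi> \<and> g = list_encode (map tm_code ts))"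
  by (cases t; auto)+

lemma fm_code_iff [simp]:
  "prod_encode (0, prod_encode (f, g)) = fm_code \<phi> \<longleftrightarrow>
     (\<exists>R ts. \<phi> = Atom R ts \<and> f = recf_code R \<and> g = list_encode (map tm_code ts))"
  "prod_encode (Suc 0, x) = fm_code \<phi> \<longleftrightarrow> (\<exists>\<psi>. \<phi> = Neg \<psi> \<and> x = fm_code \<psi>)"
  "prod_encode (2, prod_encode (x, y)) = fm_code \<phi> \<longleftrightarrow>
     (\<exists>\<psi> \<chi>. \<phi> = And \<psi> \<chi> \<and> x = fm_code \<psi> \<and> y = fm_code \<chi>)"
  "prod_encode (3, prod_encode (x, y)) = fm_code \<phi> \<longleftrightarrow>
     (\<exists>\<psi> \<chi>. \<phi> = Or \<psi> \<chi> \<and> x = fm_code \<psi> \<and> y = fm_code \<chi>)"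
  by (cases \<phi>; auto)+

lemma evalue_code_eq [simp]: "evalue_code v = evalue_code w \<longleftrightarrow> v = w"
  by (cases v; cases w) auto

section \<open>The intended meaning of the relation symbols\<close>

definition env :: "nat list \<Rightarrow> nat \<Rightarrow> tm" where
  "env ns i = (if i < length ns then num (ns ! i) else Var i)"

lemma env_Nil [simp]: "env [] = Var"
  by (auto simp: env_def)

text \<open>Links the environments of the clauses to the instances in \<open>correct\<close>. The
  condition \<open>i \<le> length ts\<close> of \<open>inst\<close> is
  \<open>i < length (v # ns)\<close> here, the bound variable being entry 0.\<close>

lemma inst_num: "inst \<phi> (num v) (map num ns) = fm_subst (env (v # ns)) \<phi>"
  unfolding inst_def
  by (rule fm_subst_cong) (auto simp: env_def nth_Cons less_Suc_eq_le split: nat.split)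

text \<open>Distinct keys make a lookup by position agree with \<open>map_of\<close>.\<close>

definition table :: "nat \<Rightarrow> esubst \<Rightarrow> bool" where
  "table s T \<longleftrightarrow> (\<exists>ps. s = table_code ps \<and> distinct (map fst ps) \<and> T = std_ext (map_of ps))"

definition entry_ok :: "esubst \<Rightarrow> tm \<Rightarrow> evalue \<Rightarrow> bool" where
  "entry_ok T e v \<longleftrightarrow> (\<forall>\<phi> ns n. e = Sk \<phi> (map num ns) \<longrightarrow> v = Num n \<longrightarrow>
     sat T (fm_subst (env (n # ns)) \<phi>) \<and> (\<forall>u<n. sat T (Neg (fm_subst (env (u # ns)) \<phi>))))"

definition admissible :: "nat \<Rightarrow> fm list \<Rightarrow> bool" where
  "admissible c Cr \<longleftrightarrow> c = fms_code Cr \<and> (\<forall>C\<in>set Cr. L_fm C)"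

text \<open>Entries are judged under the assumption that \<open>s\<close> is a table, which is not
  yet known while \<open>l\<close> is only a part of it.\<close>

definition corr_sem :: "nat \<Rightarrow> nat \<Rightarrow> nat \<Rightarrow> bool" where
  "corr_sem c s l \<longleftrightarrow> (\<forall>Cr. admissible c Cr \<longrightarrow>
     (\<exists>ps. l = table_code ps \<and> distinct (map fst ps) \<and>
        (\<forall>(e, v)\<in>set ps. canonical e \<and> (\<forall>T. table s T \<longrightarrow> entry_ok T e v))))"

definition main_sem :: "nat \<Rightarrow> nat \<Rightarrow> bool" where
  "main_sem c s \<longleftrightarrow> (\<forall>Cr. admissible c Cr \<longrightarrow>
     (\<exists>ps. s = table_code ps \<and> distinct (map fst ps) \<and>
        (\<forall>(e, v)\<in>set ps. canonical e \<and> entry_ok (std_ext (map_of ps)) e v) \<and>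
        (\<forall>C\<in>set Cr. sat (std_ext (map_of ps)) C)))"

text \<open>Clauses have instances at all numbers, including those that code no syntax. Most
  meanings are therefore conditional on the arguments being codes; lists need no such guard because
  \<open>list_decode\<close> is total. The occurrence relations instead assert that a coded object
  exists, and so supply the syntax on which \<open>Corr\<close> relies.\<close>

definition interp :: "nat \<Rightarrow> nat list \<Rightarrow> bool" where
  "interp q a \<longleftrightarrow>
    (if q = Nth then a ! 1 < length (list_decode (a ! 0)) \<and> a ! 2 = list_decode (a ! 0) ! (a ! 1)
     else if q = Neq then a ! 0 \<noteq> a ! 1
     else if q = Fresh then \<forall>p\<in>set (list_decode (a ! 1)). fst (prod_decode p) \<noteq> a ! 0
     else if q = Len then length (list_decode (a ! 0)) = length (list_decode (a ! 1))
     else if q = Ev then \<forall>F. a ! 0 = recf_code F \<longrightarrow> rec_eval F (list_decode (a ! 1)) (a ! 2)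
     else if q = Evs then \<forall>G. list_decode (a ! 0) = map recf_code G \<longrightarrow>
       list_all2 (\<lambda>g y. rec_eval g (list_decode (a ! 1)) y) G (list_decode (a ! 2))
     else if q = Numl then a ! 1 = tm_code (num (a ! 0))
     else if q = Nums then list_decode (a ! 1) = map tm_code (map num (list_decode (a ! 0)))
     else if q = Val then \<forall>T t. table (a ! 0) T \<longrightarrow> a ! 2 = tm_code t \<longrightarrow>
       eval T (tm_subst (env (list_decode (a ! 1))) t) = num (a ! 3)
     else if q = Vals then \<forall>T ts. table (a ! 0) T \<longrightarrow> list_decode (a ! 2) = map tm_code ts \<longrightarrow>
       map (\<lambda>t. eval T (tm_subst (env (list_decode (a ! 1))) t)) ts = map num (list_decode (a ! 3))
     else if q = Sat then \<forall>T \<phi>. table (a ! 0) T \<longrightarrow> a ! 2 = fm_code \<phi> \<longrightarrow>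
       sat T (fm_subst (env (list_decode (a ! 1))) \<phi>)
     else if q = Unsat then \<forall>T \<phi>. table (a ! 0) T \<longrightarrow> a ! 2 = fm_code \<phi> \<longrightarrow>
       sat T (Neg (fm_subst (env (list_decode (a ! 1))) \<phi>))
     else if q = Below then \<forall>T \<phi>. table (a ! 0) T \<longrightarrow> a ! 2 = fm_code \<phi> \<longrightarrow>
       (\<forall>u<a ! 3. sat T (Neg (fm_subst (env (u # list_decode (a ! 1))) \<phi>)))
     else if q = OccF then \<forall>Cr. admissible (a ! 0) Cr \<longrightarrow> (\<exists>\<phi>. a ! 1 = fm_code \<phi> \<and> L_fm \<phi>)
     else if q = OccT then \<forall>Cr. admissible (a ! 0) Cr \<longrightarrow> (\<exists>t. a ! 1 = tm_code t \<and> L_tm t)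
     else if q = Corr then corr_sem (a ! 0) (a ! 1) (a ! 2)
     else if q = Solv then \<forall>T Cr. table (a ! 0) T \<longrightarrow> list_decode (a ! 1) = map fm_code Cr \<longrightarrow>
       (\<forall>C\<in>set Cr. sat T C)
     else if q = Main then main_sem (a ! 0) (a ! 1)
     else True)"

definition interp_code :: "nat \<Rightarrow> bool" where
  "interp_code x \<longleftrightarrow> interp (fst (prod_decode x)) (list_decode (snd (prod_decode x)))"

lemma interp_code_atom [simp]: "interp_code (atom_code q xs) \<longleftrightarrow> interp q xs"
  by (simp add: interp_code_def atom_code_def)

definition sound :: "hclause list \<Rightarrow> bool" where
  "sound cls \<longleftrightarrow> (\<forall>(ps, c)\<in>set cls. \<forall>\<rho>.
     (\<forall>p\<in>set ps. interp_code (hval \<rho> p)) \<longrightarrow> interp_code (hval \<rho> c))"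

section \<open>Soundness of each group of clauses\<close>

lemma sound_list_clauses: "sound list_clauses"
  unfolding sound_def list_clauses_def Let_def
  by (simp add: interp_def)

lemma sound_ev_clauses: "sound ev_clauses"
  unfolding sound_def ev_clauses_def Let_def
  by (auto simp add: interp_def Cons_eq_map_conv intro: rec_eval.intros rec_eval_proj)

lemma sound_num_clauses: "sound num_clauses"
  unfolding sound_def num_clauses_def Let_def
  by (simp add: interp_def)

lemma table_lookup:
  assumes "table s T" "i < length (list_decode s)"
    "prod_encode (tm_code e, evalue_code v) = list_decode s ! i"
  shows "T e = Some v"
proof -
  obtain ps where ps: "s = table_code ps" "distinct (map fst ps)" "T = std_ext (map_of ps)"
    using assms(1) by (auto simp: table_def)
  have "ps ! i = (e, v)" "i < length ps"
    using assms(2,3) by (auto simp: ps(1) table_code_def split: prod.splits dest: tm_code_eq)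
  then have "map_of ps e = Some v" using ps(2) by (metis map_of_eq_Some_iff nth_mem)
  then show ?thesis by (auto simp: ps(3) std_ext_def)
qed

lemma eval_Sk_table:
  assumes "table s T" "i < length (list_decode s)"
    and "prod_encode (prod_encode (3, prod_encode (fm_code \<phi>, y)), evalue_code v) = list_decode s ! i"
    and "list_decode y = map (tm_code \<circ> num) (list_decode k)"
    and "map (\<lambda>t. eval T (tm_subst \<sigma> t)) ts = map num (list_decode k)"
  shows "eval T (Sk \<phi> (map (tm_subst \<sigma>) ts)) = (case v of Unknown \<Rightarrow> Zero | Num n \<Rightarrow> num n)"
proof -
  have "y = list_encode (map tm_code (map num (list_decode k)))"
    using assms(4) by (metis list_decode_inverse map_map)
  then have "T (Sk \<phi> (map num (list_decode k))) = Some v"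
    using assms(1-3) by (intro table_lookup) auto
  moreover have "map (eval T) (map (tm_subst \<sigma>) ts) = map num (list_decode k)"
    using assms(5) by (simp add: comp_def)
  moreover have "set (map num ns) \<subseteq> range num" for ns by auto
  ultimately show ?thesis by (simp only: eval.simps Let_def if_True option.case)
qed

lemma inj_num [simp]: "inj num"
  by (rule inj_on_inverseI[of _ "\<lambda>t. val t []"]) simp

lemma eval_num [simp]: "eval T (num n) = num n"
  by (induction n) auto

lemma sound_val_clauses: "sound val_clauses"
  unfolding sound_def val_clauses_def Let_def
  using eval_Sk_table[where v = Unknown] eval_Sk_table[where v = "Num _"]
  by (auto simp add: interp_def Cons_eq_map_conv env_def simp del: eval.simps(4))

text \<open>For a positive value, functionality of \<open>rec_eval\<close> excludes the value 0, so
  the negated atom is satisfied.\<close>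

lemma sat_Atom:
  assumes "map (\<lambda>t. eval T (tm_subst \<sigma> t)) ts = map num ns" "rec_eval R ns y"
  shows "sat T (if y = 0 then Atom R (map (tm_subst \<sigma>) ts) else Neg (Atom R (map (tm_subst \<sigma>) ts)))"
  using assms by (auto simp: rel_holds_def comp_def dest: rec_eval_functional)

lemma sound_sat_clauses: "sound sat_clauses"
  unfolding sound_def sat_clauses_def Let_def
  using sat_Atom[where y = 0] sat_Atom[where y = "Suc _"]
  by (auto simp add: interp_def Cons_eq_map_conv less_Suc_eq simp del: sat.simps(1,4))

lemma sound_occ_clauses: "sound occ_clauses"
  unfolding sound_def occ_clauses_def Let_def
  by (auto simp add: interp_def admissible_def fms_code_def list_all_length Skolem_formula)

lemma interp_Corr_Nil: "interp Corr [c, s, 0]"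
  by (auto simp: interp_def corr_sem_def table_code_def intro!: exI[of _ "[]"])

text \<open>Covers both kinds of entries: for \<open>v = Unknown\<close> the premise
  \<open>entry\<close> is vacuous. Occurrence and length make the new key canonical, and freshness
  keeps the keys distinct.\<close>

lemma interp_Corr_Cons:
  assumes corr: "interp Corr [c, s, l]"
    and fresh: "interp Fresh [prod_encode (3, prod_encode (f, y)), l]"
    and occ: "interp OccT [c, prod_encode (3, prod_encode (f, g))]"
    and len: "interp Len [g, k]" and nums: "interp Nums [k, y]"
    and entry: "\<And>n. v = Num n \<Longrightarrow>
      interp Sat [s, Suc (prod_encode (n, k)), f] \<and> interp Below [s, k, f, n]"
  shows "interp Corr [c, s,
    Suc (prod_encode (prod_encode (prod_encode (3, prod_encode (f, y)), evalue_code v), l))]"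
proof -
  have "\<exists>ps. Suc (prod_encode (prod_encode (prod_encode (3, prod_encode (f, y)), evalue_code v), l)) =
      table_code ps \<and> distinct (map fst ps) \<and>
      (\<forall>(e, v)\<in>set ps. canonical e \<and> (\<forall>T. table s T \<longrightarrow> entry_ok T e v))"
    if Cr: "admissible c Cr" for Cr
  proof -
    obtain ps where ps: "l = table_code ps" "distinct (map fst ps)"
      "\<forall>(e, v)\<in>set ps. canonical e \<and> (\<forall>T. table s T \<longrightarrow> entry_ok T e v)"
      using corr Cr by (auto simp: interp_def corr_sem_def)
    obtain \<phi> ts where \<phi>: "f = fm_code \<phi>" "g = list_encode (map tm_code ts)" "(length ts, \<phi>) \<in> Skolem"
      using occ Cr by (auto simp: interp_def)
    define ns where "ns = list_decode k"
    have y: "y = list_encode (map tm_code (map num ns))"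
      using nums list_decode_inverse[of y] by (simp add: interp_def ns_def)
    have length: "length ts = length ns"
      using len \<phi>(2) by (simp add: interp_def ns_def)
    let ?e = "Sk \<phi> (map num ns)"
    have "canonical ?e"
      using \<phi>(3) length by (auto simp: canonical_def)
    moreover have "?e \<notin> fst ` set ps"
    proof
      assume "?e \<in> fst ` set ps"
      then obtain w where "(?e, w) \<in> set ps" by auto
      then have "prod_encode (tm_code ?e, evalue_code w) \<in> set (list_decode l)"
        by (force simp: ps(1) table_code_def)
      with fresh show False by (auto simp: interp_def y \<phi>(1))
    qed
    moreover have "entry_ok T ?e v" if "table s T" for T
      unfolding entry_ok_def
    proof (intro allI impI)
      fix \<phi>' ns' n assume "?e = Sk \<phi>' (map num ns')" "v = Num n"
      then show "sat T (fm_subst (env (n # ns')) \<phi>') \<and>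
          (\<forall>u<n. sat T (Neg (fm_subst (env (u # ns')) \<phi>')))"
        using entry that by (simp add: interp_def ns_def \<phi>(1))
    qed
    ultimately show ?thesis
      using ps by (intro exI[of _ "(?e, v) # ps"]) (auto simp: table_code_def y \<phi>(1))
  qed
  then show ?thesis by (simp add: interp_def corr_sem_def)
qed

text \<open>Once the examined part is all of \<open>s\<close>, the assumption in
  \<open>corr_sem\<close> that \<open>s\<close> is a table can be discharged.\<close>

lemma interp_Main:
  assumes corr: "interp Corr [c, s, s]" and solv: "interp Solv [s, c]"
  shows "interp Main [c, s]"
proof -
  have "\<exists>ps. s = table_code ps \<and> distinct (map fst ps) \<and>
      (\<forall>(e, v)\<in>set ps. canonical e \<and> entry_ok (std_ext (map_of ps)) e v) \<and>
      (\<forall>C\<in>set Cr. sat (std_ext (map_of ps)) C)"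
    if Cr: "admissible c Cr" for Cr
  proof -
    obtain ps where ps: "s = table_code ps" "distinct (map fst ps)"
      "\<forall>(e, v)\<in>set ps. canonical e \<and> (\<forall>T. table s T \<longrightarrow> entry_ok T e v)"
      using corr Cr by (auto simp: interp_def corr_sem_def)
    have table: "table s (std_ext (map_of ps))" using ps by (auto simp: table_def)
    then have "\<forall>C\<in>set Cr. sat (std_ext (map_of ps)) C"
      using solv Cr by (auto simp: interp_def admissible_def fms_code_def)
    with ps table show ?thesis by blast
  qed
  then show ?thesis by (simp add: interp_def main_sem_def)
qed

lemma interp_Solv:
  "interp Solv [s, 0]"
  "interp Sat [s, 0, x] \<Longrightarrow> interp Solv [s, l] \<Longrightarrow> interp Solv [s, Suc (prod_encode (x, l))]"
  by (auto simp: interp_def Cons_eq_map_conv)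

lemma sound_corr_clauses: "sound corr_clauses"
  unfolding sound_def corr_clauses_def Let_def
  using interp_Corr_Cons[where v = Unknown] interp_Corr_Cons[where v = "Num _"]
  by (auto intro: interp_Corr_Nil interp_Main interp_Solv)

lemma sound_clauses: "sound clauses"
  using sound_list_clauses sound_ev_clauses sound_num_clauses sound_val_clauses sound_sat_clauses
    sound_occ_clauses sound_corr_clauses
  unfolding sound_def clauses_def set_append ball_Un by blast

lemma derives_sound: "derivable clauses x \<Longrightarrow> interp_code x"
proof (induction rule: derivable.induct)
  case (1 ps c \<rho>)
  then show ?case using sound_clauses by (fastforce simp: sound_def)
qed

section \<open>The program and its correctness\<close>

theorem mainTheorem1:
  "\<exists>p. \<forall>Cr. (\<forall>C\<in>set Cr. critical C \<and> fm_vars C = {}) \<longrightarrow>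
     (\<exists>m S. rec_eval p [fms_code Cr] m \<and> codes_esubst m S \<and>
        eps_subst S \<and> finite (dom S) \<and> correct S \<and> solving S Cr)"
proof -
  obtain p where p: "\<And>c. \<exists>m. derives Main [c, m] \<Longrightarrow> \<exists>m. rec_eval p [c] m \<and> derives Main [c, m]"
    using derivable_search[of clauses Main] by blast
  have "\<exists>m S. rec_eval p [fms_code Cr] m \<and> codes_esubst m S \<and>
      eps_subst S \<and> finite (dom S) \<and> correct S \<and> solving S Cr"
    if Cr: "\<forall>C\<in>set Cr. critical C \<and> fm_vars C = {}" for Cr
  proof -
    obtain m where m: "rec_eval p [fms_code Cr] m" "derives Main [fms_code Cr, m]"
      using p derives_main[OF Cr] by blast
    have "admissible (fms_code Cr) Cr" using Cr by (simp add: admissible_def critical_def)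
    \<comment> \<open>The number found need not be the one built from the standard model, so its
      properties are drawn from soundness alone.\<close>
    with derives_sound[OF m(2)] obtain ps where ps: "m = table_code ps" "distinct (map fst ps)"
      "\<forall>(e, v)\<in>set ps. canonical e \<and> entry_ok (std_ext (map_of ps)) e v"
      "\<forall>C\<in>set Cr. sat (std_ext (map_of ps)) C"
      by (auto simp: interp_def main_sem_def)
    let ?S = "map_of ps"
    have mem: "canonical e \<and> entry_ok (std_ext ?S) e v" if "?S e = Some v" for e v
      using map_of_SomeD[OF that] ps(3) by auto
    have "sat (std_ext ?S) (inst \<phi> (num v) ts) \<and> (\<forall>u<v. sat (std_ext ?S) (Neg (inst \<phi> (num u) ts)))"
      if S: "?S (Sk \<phi> ts) = Some (Num v)" for \<phi> ts v
    proof -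
      \<comment> \<open>Keys of the table are canonical, so the parameters are numerals and
        \<open>inst_num\<close> applies.\<close>
      obtain ns where "ts = map num ns" using mem[OF S] by (auto simp: canonical_def)
      with mem[OF S] show ?thesis by (simp add: entry_ok_def inst_num)
    qed
    then have "correct ?S" by (simp add: correct_def)
    moreover have "codes_esubst m ?S"
      using ps(1,2) by (auto simp: codes_esubst_def table_code_def)
    moreover have "eps_subst ?S" using mem by (auto simp: eps_subst_def)
    moreover have "solving ?S Cr" using ps(4) by (simp add: solving_def)
    ultimately show ?thesis using m(1) finite_dom_map_of by blast
  qed
  then show ?thesis by blast
qed

end
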